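(* Let $P$ be a join-factorization lattice, and let $F\colon P\to\mathcal{M}$ be a functor to a good model category. For $x\in P$, let $\operatorname{hocolim}_k T_kF(x)$ denote the homotopy colimit of the telescope $T_0F(x)\to T_1F(x)\to T_2F(x)\to\cdots$. Then for every $x\in P$ the induced map $$\operatorname{hocolim}_k T_kF(x)\to F(x)$$ is a weak equivalence.
   Context: A lattice is a poset with all binary joins $\vee$ and meets $\wedge$, viewed as a category; it is distributive if $x\wedge(y\vee z)=(x\wedge y)\vee(x\wedge z)$ for all $x,y,z$. A model category $\mathcal{M}$ is good if $\operatorname{Fun}(P,\mathcal{M})$ admits the projective model structure for every poset $P$. Join-dimension. Let $P$ be a distributive lattice. An element $v$ is join-irreducible if there are no $x,y<v$ with $v=x\vee y$. A join-decomposition of $v$ of size $k$ is a finite collection $p^0,\dots,p^{k-1}$ with $v=p^0\vee\dots\vee p^{k-1}$; it is reduced if omitting any one $p^i$ gives a join different from $v$ (by convention the size 1 decomposition $p^0=v$ is reduced unless $v$ is minimal), and indecomposable if all $p^i$ are join-irreducible. An indecomposable reduced join-decomposition is unique if it exists. Put $\operatorname{jdim}(v)=0$ if $v$ is minimal in $P$; $\operatorname{jdim}(v)=k$ if $v$ is not minimal and has a reduced indecomposable join-decomposition of size $k$; and $\operatorname{jdim}(v)=\infty$ otherwise. Let $P_{\le k}=\{v\in P:\operatorname{jdim}(v)\le k\}$. A join-factorization lattice is a distributive lattice $P$ with a minimal element for which there exist a distributive lattice $Q$ satisfying the descending chain condition (every nonempty subset of $Q$ has a minimal element) and an order-preserving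 function $f\colon P\to Q$ with $\operatorname{jdim}(f(v))=\operatorname{jdim}(v)$ for all $v\in P$. The codegree $k$ approximation $T_kF$ of $F$ is the homotopy left Kan extension of $F|_{P_{\le k}}$ along the inclusion $P_{\le k}\hookrightarrow P$; on objects $T_kF(x)=\operatorname{hocolim}_{v\in P_{\le k},\,v\le x}F(v)$. There are canonical maps $r_k\colon T_kF\to T_{k+1}F$ and $\varepsilon_k\colon T_kF\to F$ with $\varepsilon_{k+1}\circ r_k=\varepsilon_k$. Concretely: choose projectively cofibrant replacements $q_k\colon Q_k\to F|_{P_{\le k}}$ that are acyclic fibrations, and lifts $l_k\colon Q_k\to Q_{k+1}|_{P_{\le k}}$ with $q_{k+1}|_{P_{\le k}}\circ l_k=q_k$; then $T_kF$ is the left Kan extension of $Q_k$ along $P_{\le k}\hookrightarrow P$, and $\varepsilon_k$, $r_k$ are induced by $q_k$, $l_k$ through the universal property of left Kan extensions. The telescope has structure maps $(r_k)_x$, and the induced map is induced by the cocone $(\varepsilon_k)_x$. The homotopy colimit of a telescope $T\colon\mathbb{N}\to\mathcal{M}$ is the colimit of a projectively cofibrant replacement of $T$. *)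

theory Defs
  imports "HOL-Algebra.Lattice" "HOL-Library.Extended_Nat" "HOL-Library.FuncSet"
begin

section \<open>Categories, functors and natural transformations\<close>

record ('o, 'a) cat =
  Obj :: "'o set"
  Arr :: "'a set"
  Dom :: "'a \<Rightarrow> 'o"
  Cod :: "'a \<Rightarrow> 'o"
  Id :: "'o \<Rightarrow> 'a"
  Comp :: "'a \<Rightarrow> 'a \<Rightarrow> 'a"  (infixl \<open>\<cdot>\<index>\<close> 70)

definition hom :: "('o, 'a, 'm) cat_scheme \<Rightarrow> 'o \<Rightarrow> 'o \<Rightarrow> 'a set" where
  "hom C X Y = {f \<in> Arr C. Dom C f = X \<and> Cod C f = Y}"

locale category =
  fixes C :: "('o, 'a, 'm) cat_scheme" (structure)
  assumes Dom_in_Obj: "f \<in> Arr C \<Longrightarrow> Dom C f \<in> Obj C"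
    and Cod_in_Obj: "f \<in> Arr C \<Longrightarrow> Cod C f \<in> Obj C"
    and Id_in_hom: "X \<in> Obj C \<Longrightarrow> Id C X \<in> hom C X X"
    and Comp_in_hom: "f \<in> hom C X Y \<Longrightarrow> g \<in> hom C Y Z \<Longrightarrow> g \<cdot> f \<in> hom C X Z"
    and Comp_Id: "f \<in> hom C X Y \<Longrightarrow> f \<cdot> Id C X = f"
    and Id_Comp: "f \<in> hom C X Y \<Longrightarrow> Id C Y \<cdot> f = f"
    and Comp_assoc:
      "f \<in> hom C W X \<Longrightarrow> g \<in> hom C X Y \<Longrightarrow> h \<in> hom C Y Z \<Longrightarrow> (h \<cdot> g) \<cdot> f = h \<cdot> (g \<cdot> f)"

record ('co, 'ca, 'do, 'da) ftor =
  fobj :: "'co \<Rightarrow> 'do"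
  farr :: "'ca \<Rightarrow> 'da"

text \<open>The object and arrow maps of a functor are extensional (\<^const>\<open>undefined\<close> outside the
  source category), so that functors that agree on the source category are equal.\<close>

definition is_functor ::
  "('co, 'ca, 'm) cat_scheme \<Rightarrow> ('do, 'da, 'n) cat_scheme \<Rightarrow> ('co, 'ca, 'do, 'da) ftor \<Rightarrow> bool" where
  "is_functor C D F \<longleftrightarrow>
     fobj F \<in> Obj C \<rightarrow>\<^sub>E Obj D \<and> farr F \<in> Arr C \<rightarrow>\<^sub>E Arr D \<and>
     (\<forall>X Y. \<forall>f \<in> hom C X Y. farr F f \<in> hom D (fobj F X) (fobj F Y)) \<and>
     (\<forall>X \<in> Obj C. farr F (Id C X) = Id D (fobj F X)) \<and>
     (\<forall>X Y Z. \<forall>f \<in> hom C X Y. \<forall>g \<in> hom C Y Z.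
        farr F (g \<cdot>\<^bsub>C\<^esub> f) = farr F g \<cdot>\<^bsub>D\<^esub> farr F f)"

record ('co, 'ca, 'do, 'da) ntrans =
  ndom :: "('co, 'ca, 'do, 'da) ftor"
  ncod :: "('co, 'ca, 'do, 'da) ftor"
  ncomp :: "'co \<Rightarrow> 'da"

definition is_ntrans ::
  "('co, 'ca, 'm) cat_scheme \<Rightarrow> ('do, 'da, 'n) cat_scheme \<Rightarrow> ('co, 'ca, 'do, 'da) ntrans \<Rightarrow> bool" where
  "is_ntrans C D \<tau> \<longleftrightarrow>
     is_functor C D (ndom \<tau>) \<and> is_functor C D (ncod \<tau>) \<and> ncomp \<tau> \<in> extensional (Obj C) \<and>
     (\<forall>X \<in> Obj C. ncomp \<tau> X \<in> hom D (fobj (ndom \<tau>) X) (fobj (ncod \<tau>) X)) \<and>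
     (\<forall>X Y. \<forall>f \<in> hom C X Y.
        ncomp \<tau> Y \<cdot>\<^bsub>D\<^esub> farr (ndom \<tau>) f = farr (ncod \<tau>) f \<cdot>\<^bsub>D\<^esub> ncomp \<tau> X)"

definition Fun ::
  "('co, 'ca, 'm) cat_scheme \<Rightarrow> ('do, 'da, 'n) cat_scheme \<Rightarrow>
   (('co, 'ca, 'do, 'da) ftor, ('co, 'ca, 'do, 'da) ntrans) cat" where
  "Fun C D =
     \<lparr>Obj = {F. is_functor C D F},
      Arr = {\<tau>. is_ntrans C D \<tau>},
      Dom = ndom,
      Cod = ncod,
      Id = (\<lambda>F. \<lparr>ndom = F, ncod = F, ncomp = (\<lambda>X \<in> Obj C. Id D (fobj F X))\<rparr>),
      Comp = (\<lambda>\<tau> \<sigma>. \<lparr>ndom = ndom \<sigma>, ncod = ncod \<tau>,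
                      ncomp = (\<lambda>X \<in> Obj C. ncomp \<tau> X \<cdot>\<^bsub>D\<^esub> ncomp \<sigma> X)\<rparr>)\<rparr>"

definition fcomp ::
  "('co, 'ca, 'm) cat_scheme \<Rightarrow> ('do, 'da, 'eo, 'ea) ftor \<Rightarrow> ('co, 'ca, 'do, 'da) ftor \<Rightarrow>
   ('co, 'ca, 'eo, 'ea) ftor" where
  "fcomp C G K = \<lparr>fobj = (\<lambda>X \<in> Obj C. fobj G (fobj K X)), farr = (\<lambda>f \<in> Arr C. farr G (farr K f))\<rparr>"

definition whisker ::
  "('co, 'ca, 'm) cat_scheme \<Rightarrow> ('do, 'da, 'eo, 'ea) ntrans \<Rightarrow> ('co, 'ca, 'do, 'da) ftor \<Rightarrow>
   ('co, 'ca, 'eo, 'ea) ntrans" where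
  "whisker C \<tau> K =
     \<lparr>ndom = fcomp C (ndom \<tau>) K, ncod = fcomp C (ncod \<tau>) K,
      ncomp = (\<lambda>X \<in> Obj C. ncomp \<tau> (fobj K X))\<rparr>"

text \<open>The inclusion of a subcategory \<open>C\<close> into any ambient category; precomposing or whiskering
  with it is restriction to \<open>C\<close>.\<close>

definition incl :: "('o, 'a, 'm) cat_scheme \<Rightarrow> ('o, 'a, 'o, 'a) ftor" where
  "incl C = \<lparr>fobj = (\<lambda>X \<in> Obj C. X), farr = (\<lambda>f \<in> Arr C. f)\<rparr>"

definition const_functor ::
  "('jo, 'ja, 'm) cat_scheme \<Rightarrow> ('o, 'a, 'n) cat_scheme \<Rightarrow> 'o \<Rightarrow> ('jo, 'ja, 'o, 'a) ftor" where
  "const_functor J C X = \<lparr>fobj = (\<lambda>j \<in> Obj J. X), farr = (\<lambda>f \<in> Arr J. Id C X)\<rparr>"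

definition poset_cat :: "('p, 'm) gorder_scheme \<Rightarrow> ('p, 'p \<times> 'p) cat" where
  "poset_cat P =
     \<lparr>Obj = carrier P,
      Arr = {(x, y). x \<in> carrier P \<and> y \<in> carrier P \<and> x \<sqsubseteq>\<^bsub>P\<^esub> y},
      Dom = fst,
      Cod = snd,
      Id = (\<lambda>x. (x, x)),
      Comp = (\<lambda>g f. (fst f, snd g))\<rparr>"

definition nat_poset :: "nat gorder" where
  "nat_poset = \<lparr>carrier = UNIV, eq = (=), le = (\<le>)\<rparr>"


section \<open>Limits, colimits and left Kan extensions\<close>

definition is_initial :: "('o, 'a, 'm) cat_scheme \<Rightarrow> 'o \<Rightarrow> bool" where
  "is_initial C X \<longleftrightarrow> X \<in> Obj C \<and> (\<forall>Y \<in> Obj C. \<exists>!f. f \<in> hom C X Y)"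

definition is_colimit ::
  "('jo, 'ja, 'm) cat_scheme \<Rightarrow> ('o, 'a, 'n) cat_scheme \<Rightarrow> ('jo, 'ja, 'o, 'a) ftor \<Rightarrow>
   'o \<Rightarrow> ('jo, 'ja, 'o, 'a) ntrans \<Rightarrow> bool" where
  "is_colimit J C D L \<iota> \<longleftrightarrow>
     L \<in> Obj C \<and> \<iota> \<in> hom (Fun J C) D (const_functor J C L) \<and>
     (\<forall>X \<in> Obj C. \<forall>\<kappa> \<in> hom (Fun J C) D (const_functor J C X).
        \<exists>!u. u \<in> hom C L X \<and> (\<forall>j \<in> Obj J. u \<cdot>\<^bsub>C\<^esub> ncomp \<iota> j = ncomp \<kappa> j))"

definition is_limit ::
  "('jo, 'ja, 'm) cat_scheme \<Rightarrow> ('o, 'a, 'n) cat_scheme \<Rightarrow> ('jo, 'ja, 'o, 'a) ftor \<Rightarrow>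
   'o \<Rightarrow> ('jo, 'ja, 'o, 'a) ntrans \<Rightarrow> bool" where
  "is_limit J C D L \<pi> \<longleftrightarrow>
     L \<in> Obj C \<and> \<pi> \<in> hom (Fun J C) (const_functor J C L) D \<and>
     (\<forall>X \<in> Obj C. \<forall>\<kappa> \<in> hom (Fun J C) (const_functor J C X) D.
        \<exists>!u. u \<in> hom C X L \<and> (\<forall>j \<in> Obj J. ncomp \<pi> j \<cdot>\<^bsub>C\<^esub> u = ncomp \<kappa> j))"

definition colim_induced ::
  "('jo, 'ja, 'm) cat_scheme \<Rightarrow> ('o, 'a, 'n) cat_scheme \<Rightarrow> 'o \<Rightarrow> ('jo, 'ja, 'o, 'a) ntrans \<Rightarrow>
   'o \<Rightarrow> ('jo, 'ja, 'o, 'a) ntrans \<Rightarrow> 'a" where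
  "colim_induced J C L \<iota> X \<kappa> =
     (THE u. u \<in> hom C L X \<and> (\<forall>j \<in> Obj J. u \<cdot>\<^bsub>C\<^esub> ncomp \<iota> j = ncomp \<kappa> j))"

text \<open>\<open>(T, \<eta>)\<close> is a left Kan extension of \<open>Q : C \<rightarrow> E\<close> along \<open>K : C \<rightarrow> D\<close>.\<close>

definition is_left_kan_extension ::
  "('co, 'ca, 'l) cat_scheme \<Rightarrow> ('do, 'da, 'm) cat_scheme \<Rightarrow> ('eo, 'ea, 'n) cat_scheme \<Rightarrow>
   ('co, 'ca, 'do, 'da) ftor \<Rightarrow> ('co, 'ca, 'eo, 'ea) ftor \<Rightarrow> ('do, 'da, 'eo, 'ea) ftor \<Rightarrow>
   ('co, 'ca, 'eo, 'ea) ntrans \<Rightarrow> bool" where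
  "is_left_kan_extension C D E K Q T \<eta> \<longleftrightarrow>
     T \<in> Obj (Fun D E) \<and> \<eta> \<in> hom (Fun C E) Q (fcomp C T K) \<and>
     (\<forall>G \<in> Obj (Fun D E). \<forall>\<alpha> \<in> hom (Fun C E) Q (fcomp C G K).
        \<exists>!\<beta>. \<beta> \<in> hom (Fun D E) T G \<and> whisker C \<beta> K \<cdot>\<^bsub>Fun C E\<^esub> \<eta> = \<alpha>)"

definition kan_induced ::
  "('co, 'ca, 'l) cat_scheme \<Rightarrow> ('do, 'da, 'm) cat_scheme \<Rightarrow> ('eo, 'ea, 'n) cat_scheme \<Rightarrow>
   ('co, 'ca, 'do, 'da) ftor \<Rightarrow> ('do, 'da, 'eo, 'ea) ftor \<Rightarrow> ('co, 'ca, 'eo, 'ea) ntrans \<Rightarrow>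
   ('do, 'da, 'eo, 'ea) ftor \<Rightarrow> ('co, 'ca, 'eo, 'ea) ntrans \<Rightarrow> ('do, 'da, 'eo, 'ea) ntrans" where
  "kan_induced C D E K T \<eta> G \<alpha> =
     (THE \<beta>. \<beta> \<in> hom (Fun D E) T G \<and> whisker C \<beta> K \<cdot>\<^bsub>Fun C E\<^esub> \<eta> = \<alpha>)"


section \<open>Model categories\<close>

record ('o, 'a) model_struct = "('o, 'a) cat" +
  Weq :: "'a set"
  Fib :: "'a set"
  Cof :: "'a set"

definition has_lifting :: "('o, 'a, 'm) cat_scheme \<Rightarrow> 'a \<Rightarrow> 'a \<Rightarrow> bool" where
  "has_lifting C i p \<longleftrightarrow>
     (\<forall>u \<in> hom C (Dom C i) (Dom C p). \<forall>v \<in> hom C (Cod C i) (Cod C p).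
        p \<cdot>\<^bsub>C\<^esub> u = v \<cdot>\<^bsub>C\<^esub> i \<longrightarrow>
        (\<exists>h \<in> hom C (Cod C i) (Dom C p). h \<cdot>\<^bsub>C\<^esub> i = u \<and> p \<cdot>\<^bsub>C\<^esub> h = v))"

definition is_retract :: "('o, 'a, 'm) cat_scheme \<Rightarrow> 'a \<Rightarrow> 'a \<Rightarrow> bool" where
  "is_retract C f g \<longleftrightarrow>
     (\<exists>s \<in> hom C (Dom C f) (Dom C g). \<exists>r \<in> hom C (Dom C g) (Dom C f).
      \<exists>s' \<in> hom C (Cod C f) (Cod C g). \<exists>r' \<in> hom C (Cod C g) (Cod C f).
        r \<cdot>\<^bsub>C\<^esub> s = Id C (Dom C f) \<and> r' \<cdot>\<^bsub>C\<^esub> s' = Id C (Cod C f) \<and>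
        g \<cdot>\<^bsub>C\<^esub> s = s' \<cdot>\<^bsub>C\<^esub> f \<and> f \<cdot>\<^bsub>C\<^esub> r = r' \<cdot>\<^bsub>C\<^esub> g)"

definition retract_closed :: "('o, 'a, 'm) cat_scheme \<Rightarrow> 'a set \<Rightarrow> bool" where
  "retract_closed C S \<longleftrightarrow> (\<forall>f \<in> Arr C. \<forall>g \<in> S. is_retract C f g \<longrightarrow> f \<in> S)"

text \<open>The type \<open>'u\<close> plays the role of the universe: the small sets are the subsets of \<open>'u\<close>. It is
  meant to be infinite, so that the small sets include, up to bijection, \<open>\<nat>\<close> and all finite products
  of small sets. This is not imposed, because a smaller universe only makes the axioms of
  (co)completeness weaker. Factorizations are not required to be functorial.\<close>

locale model_category = category M
  for U :: "'u itself" and M :: "('o, 'a, 'm) model_struct_scheme" (structure) +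
  assumes small_limits:
      "\<And>(J :: ('u, 'u) cat) D. category J \<Longrightarrow> is_functor J M D \<Longrightarrow> \<exists>L \<pi>. is_limit J M D L \<pi>"
    and small_colimits:
      "\<And>(J :: ('u, 'u) cat) D. category J \<Longrightarrow> is_functor J M D \<Longrightarrow> \<exists>L \<iota>. is_colimit J M D L \<iota>"
    and Weq_subset: "Weq M \<subseteq> Arr M"
    and Fib_subset: "Fib M \<subseteq> Arr M"
    and Cof_subset: "Cof M \<subseteq> Arr M"
    and two_of_three:
      "\<And>X Y Z f g. f \<in> hom M X Y \<Longrightarrow> g \<in> hom M Y Z \<Longrightarrow>
         (f \<in> Weq M \<and> g \<in> Weq M \<longrightarrow> g \<cdot> f \<in> Weq M) \<and>
         (f \<in> Weq M \<and> g \<cdot> f \<in> Weq M \<longrightarrow> g \<in> Weq M) \<and>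
         (g \<in> Weq M \<and> g \<cdot> f \<in> Weq M \<longrightarrow> f \<in> Weq M)"
    and retracts: "retract_closed M (Weq M)" "retract_closed M (Fib M)" "retract_closed M (Cof M)"
    and lifting_cof_acyclic_fib:
      "\<And>i p. i \<in> Cof M \<Longrightarrow> p \<in> Fib M \<inter> Weq M \<Longrightarrow> has_lifting M i p"
    and lifting_acyclic_cof_fib:
      "\<And>i p. i \<in> Cof M \<inter> Weq M \<Longrightarrow> p \<in> Fib M \<Longrightarrow> has_lifting M i p"
    and factor_cof_acyclic_fib:
      "\<And>X Y f. f \<in> hom M X Y \<Longrightarrow>
         \<exists>Z. \<exists>i \<in> hom M X Z \<inter> Cof M. \<exists>p \<in> hom M Z Y \<inter> Fib M \<inter> Weq M. f = p \<cdot> i"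
    and factor_acyclic_cof_fib:
      "\<And>X Y f. f \<in> hom M X Y \<Longrightarrow>
         \<exists>Z. \<exists>i \<in> hom M X Z \<inter> Cof M \<inter> Weq M. \<exists>p \<in> hom M Z Y \<inter> Fib M. f = p \<cdot> i"

definition cofibrant :: "('o, 'a, 'm) model_struct_scheme \<Rightarrow> 'o \<Rightarrow> bool" where
  "cofibrant M X \<longleftrightarrow> (\<exists>I f. is_initial M I \<and> f \<in> hom M I X \<and> f \<in> Cof M)"

text \<open>The candidate for the projective model structure on \<open>Fun C M\<close>: weak equivalences and
  fibrations are objectwise, and cofibrations have the left lifting property against the objectwise
  acyclic fibrations. \<open>Fun C M\<close> admits the projective model structure iff this is a model category.\<close>

definition proj_model ::
  "('co, 'ca, 'l) cat_scheme \<Rightarrow> ('o, 'a, 'm) model_struct_scheme \<Rightarrow>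
   (('co, 'ca, 'o, 'a) ftor, ('co, 'ca, 'o, 'a) ntrans) model_struct" where
  "proj_model C M =
     \<lparr>Obj = Obj (Fun C M), Arr = Arr (Fun C M), Dom = Dom (Fun C M), Cod = Cod (Fun C M),
      Id = Id (Fun C M), Comp = Comp (Fun C M),
      Weq = {\<tau> \<in> Arr (Fun C M). \<forall>X \<in> Obj C. ncomp \<tau> X \<in> Weq M},
      Fib = {\<tau> \<in> Arr (Fun C M). \<forall>X \<in> Obj C. ncomp \<tau> X \<in> Fib M},
      Cof = {\<tau> \<in> Arr (Fun C M). \<forall>\<pi> \<in> Arr (Fun C M).
               (\<forall>X \<in> Obj C. ncomp \<pi> X \<in> Fib M \<inter> Weq M) \<longrightarrow> has_lifting (Fun C M) \<tau> \<pi>}\<rparr>"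

definition good_model_category :: "'u itself \<Rightarrow> ('o, 'a, 'm) model_struct_scheme \<Rightarrow> bool" where
  "good_model_category U M \<longleftrightarrow>
     model_category U M \<and>
     (\<forall>A :: 'u gorder. partial_order A \<longrightarrow> model_category U (proj_model (poset_cat A) M))"


section \<open>Join-dimension and join-factorization lattices\<close>

definition distributive_lattice :: "('p, 'm) gorder_scheme \<Rightarrow> bool" where
  "distributive_lattice P \<longleftrightarrow>
     lattice P \<and>
     (\<forall>x \<in> carrier P. \<forall>y \<in> carrier P. \<forall>z \<in> carrier P.
        x \<sqinter>\<^bsub>P\<^esub> (y \<squnion>\<^bsub>P\<^esub> z) = (x \<sqinter>\<^bsub>P\<^esub> y) \<squnion>\<^bsub>P\<^esub> (x \<sqinter>\<^bsub>P\<^esub> z))"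

definition minimal_in :: "('p, 'm) gorder_scheme \<Rightarrow> 'p set \<Rightarrow> 'p \<Rightarrow> bool" where
  "minimal_in P S v \<longleftrightarrow> v \<in> S \<and> \<not> (\<exists>y \<in> S. y \<sqsubset>\<^bsub>P\<^esub> v)"

definition join_irreducible :: "('p, 'm) gorder_scheme \<Rightarrow> 'p \<Rightarrow> bool" where
  "join_irreducible P v \<longleftrightarrow>
     v \<in> carrier P \<and>
     \<not> (\<exists>x \<in> carrier P. \<exists>y \<in> carrier P. x \<sqsubset>\<^bsub>P\<^esub> v \<and> y \<sqsubset>\<^bsub>P\<^esub> v \<and> v = x \<squnion>\<^bsub>P\<^esub> y)"

text \<open>A decomposition of size \<open>k\<close> is a family \<open>p 0, \<dots>, p (k - 1)\<close>.\<close>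

definition join_decomposition ::
  "('p, 'm) gorder_scheme \<Rightarrow> 'p \<Rightarrow> nat \<Rightarrow> (nat \<Rightarrow> 'p) \<Rightarrow> bool" where
  "join_decomposition P v k p \<longleftrightarrow>
     k \<ge> 1 \<and> p \<in> {..<k} \<rightarrow> carrier P \<and> v = \<Squnion>\<^bsub>P\<^esub>(p ` {..<k})"

definition reduced_decomposition ::
  "('p, 'm) gorder_scheme \<Rightarrow> 'p \<Rightarrow> nat \<Rightarrow> (nat \<Rightarrow> 'p) \<Rightarrow> bool" where
  "reduced_decomposition P v k p \<longleftrightarrow>
     (if k = 1 then \<not> minimal_in P (carrier P) v
      else \<forall>i < k. \<Squnion>\<^bsub>P\<^esub>(p ` ({..<k} - {i})) \<noteq> v)"

definition has_reduced_indecomposable :: "('p, 'm) gorder_scheme \<Rightarrow> 'p \<Rightarrow> nat \<Rightarrow> bool" where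
  "has_reduced_indecomposable P v k \<longleftrightarrow>
     (\<exists>p. join_decomposition P v k p \<and> reduced_decomposition P v k p \<and>
          (\<forall>i < k. join_irreducible P (p i)))"

definition jdim :: "('p, 'm) gorder_scheme \<Rightarrow> 'p \<Rightarrow> enat" where
  "jdim P v =
     (if minimal_in P (carrier P) v then 0
      else if \<exists>k. has_reduced_indecomposable P v k
      then enat (THE k. has_reduced_indecomposable P v k)
      else \<infinity>)"

definition jdim_le :: "('p, 'm) gorder_scheme \<Rightarrow> nat \<Rightarrow> ('p, 'm) gorder_scheme" where
  "jdim_le P k = P\<lparr>carrier := {v \<in> carrier P. jdim P v \<le> enat k}\<rparr>"

text \<open>One cannot quantify existentially over the type of elements of the lattice \<open>Q\<close>, so that type is
  a parameter. In a hypothesis of a theorem, a type variable as the parameter expresses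
  ``there exists''.\<close>

definition join_factorization_lattice :: "'q itself \<Rightarrow> ('p, 'm) gorder_scheme \<Rightarrow> bool" where
  "join_factorization_lattice _ P \<longleftrightarrow>
     distributive_lattice P \<and> (\<exists>v. minimal_in P (carrier P) v) \<and>
     (\<exists>(Q :: 'q gorder) f.
        distributive_lattice Q \<and>
        (\<forall>S \<subseteq> carrier Q. S \<noteq> {} \<longrightarrow> (\<exists>m. minimal_in Q S m)) \<and>
        f \<in> carrier P \<rightarrow> carrier Q \<and> isotone P Q f \<and>
        (\<forall>v \<in> carrier P. jdim Q (f v) = jdim P v))"


section \<open>Codegree approximations\<close>

abbreviation Pcat :: "('p, 'm) gorder_scheme \<Rightarrow> nat \<Rightarrow> ('p, 'p \<times> 'p) cat" where
  "Pcat P k \<equiv> poset_cat (jdim_le P k)"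

text \<open>The choices in the construction of the approximations \<open>T k = T\<^sub>kF\<close>, with \<open>\<eta> k\<close> the unit of the
  left Kan extension \<open>T k\<close>.\<close>

definition codegree_choices ::
  "('p, 'n) gorder_scheme \<Rightarrow> ('o, 'a, 'm) model_struct_scheme \<Rightarrow> ('p, 'p \<times> 'p, 'o, 'a) ftor \<Rightarrow>
   (nat \<Rightarrow> ('p, 'p \<times> 'p, 'o, 'a) ftor) \<Rightarrow> (nat \<Rightarrow> ('p, 'p \<times> 'p, 'o, 'a) ntrans) \<Rightarrow>
   (nat \<Rightarrow> ('p, 'p \<times> 'p, 'o, 'a) ntrans) \<Rightarrow> (nat \<Rightarrow> ('p, 'p \<times> 'p, 'o, 'a) ftor) \<Rightarrow>
   (nat \<Rightarrow> ('p, 'p \<times> 'p, 'o, 'a) ntrans) \<Rightarrow> bool" where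
  "codegree_choices P M F Q q l T \<eta> \<longleftrightarrow>
     (\<forall>k. cofibrant (proj_model (Pcat P k) M) (Q k) \<and>
          q k \<in> hom (Fun (Pcat P k) M) (Q k) (fcomp (Pcat P k) F (incl (Pcat P k))) \<and>
          q k \<in> Fib (proj_model (Pcat P k) M) \<inter> Weq (proj_model (Pcat P k) M) \<and>
          l k \<in> hom (Fun (Pcat P k) M) (Q k) (fcomp (Pcat P k) (Q (Suc k)) (incl (Pcat P k))) \<and>
          whisker (Pcat P k) (q (Suc k)) (incl (Pcat P k)) \<cdot>\<^bsub>Fun (Pcat P k) M\<^esub> l k = q k \<and>
          is_left_kan_extension (Pcat P k) (poset_cat P) M (incl (Pcat P k)) (Q k) (T k) (\<eta> k))"

definition codegree_counit ::
  "('p, 'n) gorder_scheme \<Rightarrow> ('o, 'a, 'm) model_struct_scheme \<Rightarrow> ('p, 'p \<times> 'p, 'o, 'a) ftor \<Rightarrow>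
   (nat \<Rightarrow> ('p, 'p \<times> 'p, 'o, 'a) ntrans) \<Rightarrow> (nat \<Rightarrow> ('p, 'p \<times> 'p, 'o, 'a) ftor) \<Rightarrow>
   (nat \<Rightarrow> ('p, 'p \<times> 'p, 'o, 'a) ntrans) \<Rightarrow> nat \<Rightarrow> ('p, 'p \<times> 'p, 'o, 'a) ntrans" where
  "codegree_counit P M F q T \<eta> k =
     kan_induced (Pcat P k) (poset_cat P) M (incl (Pcat P k)) (T k) (\<eta> k) F (q k)"

definition codegree_step ::
  "('p, 'n) gorder_scheme \<Rightarrow> ('o, 'a, 'm) model_struct_scheme \<Rightarrow>
   (nat \<Rightarrow> ('p, 'p \<times> 'p, 'o, 'a) ntrans) \<Rightarrow> (nat \<Rightarrow> ('p, 'p \<times> 'p, 'o, 'a) ftor) \<Rightarrow>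
   (nat \<Rightarrow> ('p, 'p \<times> 'p, 'o, 'a) ntrans) \<Rightarrow> nat \<Rightarrow> ('p, 'p \<times> 'p, 'o, 'a) ntrans" where
  "codegree_step P M l T \<eta> k =
     kan_induced (Pcat P k) (poset_cat P) M (incl (Pcat P k)) (T k) (\<eta> k) (T (Suc k))
       (whisker (Pcat P k) (\<eta> (Suc k)) (incl (Pcat P k)) \<cdot>\<^bsub>Fun (Pcat P k) M\<^esub> l k)"


section \<open>Telescopes and their homotopy colimits\<close>

primrec iterated_comp ::
  "('o, 'a, 'm) cat_scheme \<Rightarrow> (nat \<Rightarrow> 'o) \<Rightarrow> (nat \<Rightarrow> 'a) \<Rightarrow> nat \<Rightarrow> nat \<Rightarrow> 'a" where
  "iterated_comp C X r i 0 = Id C (X i)"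
| "iterated_comp C X r i (Suc n) = r (i + n) \<cdot>\<^bsub>C\<^esub> iterated_comp C X r i n"

text \<open>The functor \<open>\<nat> \<rightarrow> C\<close> given by a sequence \<open>X 0 \<rightarrow> X 1 \<rightarrow> \<dots>\<close> with structure maps \<open>r k\<close>.\<close>

definition telescope ::
  "('o, 'a, 'm) cat_scheme \<Rightarrow> (nat \<Rightarrow> 'o) \<Rightarrow> (nat \<Rightarrow> 'a) \<Rightarrow> (nat, nat \<times> nat, 'o, 'a) ftor" where
  "telescope C X r =
     \<lparr>fobj = X,
      farr = (\<lambda>(i, j) \<in> Arr (poset_cat nat_poset). iterated_comp C X r i (j - i))\<rparr>"

text \<open>\<open>(L, \<iota>)\<close> is the colimit of \<open>R\<close>, where \<open>c : R \<rightarrow> D\<close> is a projectively cofibrant replacement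
  of \<open>D : J \<rightarrow> M\<close>.\<close>

definition is_hocolim ::
  "('jo, 'ja, 'l) cat_scheme \<Rightarrow> ('o, 'a, 'm) model_struct_scheme \<Rightarrow> ('jo, 'ja, 'o, 'a) ftor \<Rightarrow>
   ('jo, 'ja, 'o, 'a) ftor \<Rightarrow> ('jo, 'ja, 'o, 'a) ntrans \<Rightarrow>
   'o \<Rightarrow> ('jo, 'ja, 'o, 'a) ntrans \<Rightarrow> bool" where
  "is_hocolim J M D R c L \<iota> \<longleftrightarrow>
     cofibrant (proj_model J M) R \<and>
     c \<in> hom (Fun J M) R D \<and> c \<in> Weq (proj_model J M) \<and>
     is_colimit J M R L \<iota>"

text \<open>The map from the homotopy colimit \<open>L\<close> of \<open>D\<close> to \<open>X\<close> induced by a cocone \<open>\<kappa>\<close> from \<open>D\<close> to \<open>X\<close>.\<close>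

definition hocolim_induced ::
  "('jo, 'ja, 'l) cat_scheme \<Rightarrow> ('o, 'a, 'm) model_struct_scheme \<Rightarrow>
   ('jo, 'ja, 'o, 'a) ntrans \<Rightarrow> 'o \<Rightarrow> ('jo, 'ja, 'o, 'a) ntrans \<Rightarrow>
   'o \<Rightarrow> ('jo, 'ja, 'o, 'a) ntrans \<Rightarrow> 'a" where
  "hocolim_induced J M c L \<iota> X \<kappa> = colim_induced J M L \<iota> X (\<kappa> \<cdot>\<^bsub>Fun J M\<^esub> c)"

definition codegree_telescope ::
  "('p, 'n) gorder_scheme \<Rightarrow> ('o, 'a, 'm) model_struct_scheme \<Rightarrow>
   (nat \<Rightarrow> ('p, 'p \<times> 'p, 'o, 'a) ntrans) \<Rightarrow> (nat \<Rightarrow> ('p, 'p \<times> 'p, 'o, 'a) ftor) \<Rightarrow>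
   (nat \<Rightarrow> ('p, 'p \<times> 'p, 'o, 'a) ntrans) \<Rightarrow> 'p \<Rightarrow> (nat, nat \<times> nat, 'o, 'a) ftor" where
  "codegree_telescope P M l T \<eta> x =
     telescope M (\<lambda>k. fobj (T k) x) (\<lambda>k. ncomp (codegree_step P M l T \<eta> k) x)"

definition codegree_cocone ::
  "('p, 'n) gorder_scheme \<Rightarrow> ('o, 'a, 'm) model_struct_scheme \<Rightarrow> ('p, 'p \<times> 'p, 'o, 'a) ftor \<Rightarrow>
   (nat \<Rightarrow> ('p, 'p \<times> 'p, 'o, 'a) ntrans) \<Rightarrow> (nat \<Rightarrow> ('p, 'p \<times> 'p, 'o, 'a) ntrans) \<Rightarrow>
   (nat \<Rightarrow> ('p, 'p \<times> 'p, 'o, 'a) ftor) \<Rightarrow> (nat \<Rightarrow> ('p, 'p \<times> 'p, 'o, 'a) ntrans) \<Rightarrow> 'p \<Rightarrow>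
   (nat, nat \<times> nat, 'o, 'a) ntrans" where
  "codegree_cocone P M F q l T \<eta> x =
     \<lparr>ndom = codegree_telescope P M l T \<eta> x,
      ncod = const_functor (poset_cat nat_poset) M (fobj F x),
      ncomp = (\<lambda>k. ncomp (codegree_counit P M F q T \<eta> k) x)\<rparr>"

end

theory Submission
  imports Defs
begin

text \<open>By the descending chain condition every non-minimal element of the codomain of the factorization
  map is a finite join of join-irreducibles, so every element of \<open>P\<close> has finite join-dimension and
  \<open>x \<in> P\<^sub>\<le>\<^sub>k\<close> for all large \<open>k\<close>. For such \<open>k\<close> the unit of the Kan extension is invertible at \<open>x\<close>,
  hence \<open>T\<^sub>kF(x) \<rightarrow> F(x)\<close> is a weak equivalence. A projectively cofibrant replacement of the telescope
  therefore consists of cofibrations that are eventually acyclic, and the inclusion of a late stage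
  into its colimit lifts against all fibrations, so it is a weak equivalence too.\<close>

section \<open>Functor categories\<close>

text \<open>The replacements, the lifts, the Kan extensions and the cofibrant telescope are
  arbitrary choices, so no formula for \<open>T k\<close> or \<open>R\<close> is at hand: everything
  must come from universal and lifting properties of functors. The obstacle is to turn such a
  property into a statement about one value or one arrow of \<open>M\<close>. Step functors do this
  in both places. They carry a chosen object or arrow of \<open>M\<close> on a lower set and the
  terminal object elsewhere, so a map into one of them is governed by its part on the lower set.

  Invertibility of the unit at \<open>x\<close> reflects that \<open>x\<close> is the greatest
  element of the index poset \<open>{v \<in> P\<^sub>\<le>\<^sub>k. v \<le> x}\<close>. Acyclicity
  of the late maps of \<open>R\<close> is two-of-three: from stage \<open>k0\<close> on, the
  join-dimension of \<open>x\<close>, every stage maps to \<open>F x\<close> by a weak equivalence,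
  compatibly with the arrows of \<open>R\<close>. The stages before \<open>k0\<close> may be
  arbitrary, because the map out of the colimit is compared with \<open>F x\<close> at the single
  stage \<open>k0\<close>.\<close>

lemma hom_FunD:
  assumes "\<tau> \<in> hom (Fun C D) F G"
  shows "is_functor C D F" "is_functor C D G" "ndom \<tau> = F" "ncod \<tau> = G"
    "ncomp \<tau> \<in> extensional (Obj C)"
    "\<And>X. X \<in> Obj C \<Longrightarrow> ncomp \<tau> X \<in> hom D (fobj F X) (fobj G X)"
    "\<And>X Y f. f \<in> hom C X Y \<Longrightarrow> ncomp \<tau> Y \<cdot>\<^bsub>D\<^esub> farr F f = farr G f \<cdot>\<^bsub>D\<^esub> ncomp \<tau> X"
  using assms by (auto simp: hom_def Fun_def is_ntrans_def)

lemma hom_FunI: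
  assumes "is_functor C D F" "is_functor C D G" "ndom \<tau> = F" "ncod \<tau> = G"
    "ncomp \<tau> \<in> extensional (Obj C)"
    "\<And>X. X \<in> Obj C \<Longrightarrow> ncomp \<tau> X \<in> hom D (fobj F X) (fobj G X)"
    "\<And>X Y f. f \<in> hom C X Y \<Longrightarrow> ncomp \<tau> Y \<cdot>\<^bsub>D\<^esub> farr F f = farr G f \<cdot>\<^bsub>D\<^esub> ncomp \<tau> X"
  shows "\<tau> \<in> hom (Fun C D) F G"
  using assms by (auto simp: hom_def Fun_def is_ntrans_def)

lemma hom_Fun_eqI:
  fixes \<sigma> \<tau> :: "('co, 'ca, 'do, 'da) ntrans"
  assumes "\<sigma> \<in> hom (Fun C D) F G" "\<tau> \<in> hom (Fun C D) F G"
    and "\<And>X. X \<in> Obj C \<Longrightarrow> ncomp \<sigma> X = ncomp \<tau> X"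
  shows "\<sigma> = \<tau>"
proof -
  have "ncomp \<sigma> = ncomp \<tau>"
    by (rule extensionalityI[OF hom_FunD(5)[OF assms(1)] hom_FunD(5)[OF assms(2)] assms(3)])
  then show ?thesis
    using hom_FunD(3,4)[OF assms(1)] hom_FunD(3,4)[OF assms(2)] by simp
qed

lemma ncomp_Comp_Fun:
  "X \<in> Obj C \<Longrightarrow> ncomp (\<tau> \<cdot>\<^bsub>Fun C D\<^esub> \<sigma>) X = ncomp \<tau> X \<cdot>\<^bsub>D\<^esub> ncomp \<sigma> X"
  by (simp add: Fun_def)

lemma ncomp_whisker: "X \<in> Obj C \<Longrightarrow> ncomp (whisker C \<tau> K) X = ncomp \<tau> (fobj K X)"
  by (simp add: whisker_def)

lemma hom_ObjD:
  assumes "category C" "f \<in> hom C X Y"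
  shows "X \<in> Obj C" "Y \<in> Obj C" "f \<in> Arr C"
  using assms category.Dom_in_Obj[OF assms(1)] category.Cod_in_Obj[OF assms(1)]
  by (auto simp: hom_def)

lemma functorD:
  assumes "is_functor C D F"
  shows "X \<in> Obj C \<Longrightarrow> fobj F X \<in> Obj D"
    "f \<in> hom C X Y \<Longrightarrow> farr F f \<in> hom D (fobj F X) (fobj F Y)"
    "X \<in> Obj C \<Longrightarrow> farr F (Id C X) = Id D (fobj F X)"
    "f \<in> hom C X Y \<Longrightarrow> g \<in> hom C Y Z \<Longrightarrow> farr F (g \<cdot>\<^bsub>C\<^esub> f) = farr F g \<cdot>\<^bsub>D\<^esub> farr F f"
  using assms unfolding is_functor_def by blast+

lemma Comp_Fun_in_hom:
  assumes "category C" "category D" "\<sigma> \<in> hom (Fun C D) F G" "\<tau> \<in> hom (Fun C D) G H"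
  shows "\<tau> \<cdot>\<^bsub>Fun C D\<^esub> \<sigma> \<in> hom (Fun C D) F H"
proof (rule hom_FunI)
  interpret D: category D by fact
  note \<sigma> = hom_FunD[OF assms(3)] and \<tau> = hom_FunD[OF assms(4)]
  show "is_functor C D F" "is_functor C D H" by fact+
  show "ndom (\<tau> \<cdot>\<^bsub>Fun C D\<^esub> \<sigma>) = F" "ncod (\<tau> \<cdot>\<^bsub>Fun C D\<^esub> \<sigma>) = H"
    "ncomp (\<tau> \<cdot>\<^bsub>Fun C D\<^esub> \<sigma>) \<in> extensional (Obj C)"
    using \<sigma> \<tau> by (simp_all add: Fun_def)
  show "ncomp (\<tau> \<cdot>\<^bsub>Fun C D\<^esub> \<sigma>) X \<in> hom D (fobj F X) (fobj H X)" if "X \<in> Obj C" for X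
    using D.Comp_in_hom[OF \<sigma>(6)[OF that] \<tau>(6)[OF that]] that by (simp add: ncomp_Comp_Fun)
  fix X Y f
  assume f: "f \<in> hom C X Y"
  note ob = hom_ObjD[OF assms(1) f]
  have *: "farr F f \<in> hom D (fobj F X) (fobj F Y)" "farr G f \<in> hom D (fobj G X) (fobj G Y)"
    "farr H f \<in> hom D (fobj H X) (fobj H Y)"
    using f \<sigma>(1) \<tau>(1,2) functorD(2) by metis+
  have "ncomp \<tau> Y \<cdot>\<^bsub>D\<^esub> ncomp \<sigma> Y \<cdot>\<^bsub>D\<^esub> farr F f = ncomp \<tau> Y \<cdot>\<^bsub>D\<^esub> (farr G f \<cdot>\<^bsub>D\<^esub> ncomp \<sigma> X)"
    using D.Comp_assoc[OF *(1) \<sigma>(6) \<tau>(6)] ob \<sigma>(7)[OF f] by simp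
  also have "\<dots> = farr H f \<cdot>\<^bsub>D\<^esub> (ncomp \<tau> X \<cdot>\<^bsub>D\<^esub> ncomp \<sigma> X)"
    using D.Comp_assoc[OF \<sigma>(6) *(2) \<tau>(6)] D.Comp_assoc[OF \<sigma>(6) \<tau>(6) *(3)] ob \<tau>(7)[OF f] by simp
  finally show "ncomp (\<tau> \<cdot>\<^bsub>Fun C D\<^esub> \<sigma>) Y \<cdot>\<^bsub>D\<^esub> farr F f = farr H f \<cdot>\<^bsub>D\<^esub> ncomp (\<tau> \<cdot>\<^bsub>Fun C D\<^esub> \<sigma>) X"
    using ob by (simp add: ncomp_Comp_Fun)
qed

lemma is_functor_fcomp:
  assumes "category C" "is_functor C D K" "is_functor D E G"
  shows "is_functor C E (fcomp C G K)"
proof -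
  interpret category C by fact
  note K = functorD[OF assms(2)] and G = functorD[OF assms(3)]
  have arr: "f \<in> Arr C \<Longrightarrow> f \<in> hom C (Dom C f) (Cod C f)" for f
    by (simp add: hom_def)
  have "farr G (farr K f) \<in> Arr E" if "f \<in> Arr C" for f
    using G(2)[OF K(2)[OF arr[OF that]]] by (simp add: hom_def)
  moreover have "farr K (g \<cdot>\<^bsub>C\<^esub> f) = farr K g \<cdot>\<^bsub>D\<^esub> farr K f \<and>
      farr G (farr K g \<cdot>\<^bsub>D\<^esub> farr K f) = farr G (farr K g) \<cdot>\<^bsub>E\<^esub> farr G (farr K f)"
    if "f \<in> hom C X Y" "g \<in> hom C Y Z" for f g X Y Z
    using K(4)[OF that] G(4)[OF K(2)[OF that(1)] K(2)[OF that(2)]] by simp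
  ultimately show ?thesis
    using hom_ObjD[OF assms(1)] hom_ObjD(3)[OF assms(1) Id_in_hom]
      hom_ObjD(3)[OF assms(1) Comp_in_hom] K G
    unfolding is_functor_def fcomp_def by (simp add: PiE_def)
qed

lemma whisker_in_hom:
  assumes "category C" "is_functor C D K" "\<tau> \<in> hom (Fun D E) F G"
  shows "whisker C \<tau> K \<in> hom (Fun C E) (fcomp C F K) (fcomp C G K)"
proof (rule hom_FunI)
  note \<tau> = hom_FunD[OF assms(3)] and K = functorD[OF assms(2)]
  show "is_functor C E (fcomp C F K)" "is_functor C E (fcomp C G K)"
    using is_functor_fcomp[OF assms(1,2)] \<tau>(1,2) by auto
  show "ndom (whisker C \<tau> K) = fcomp C F K" "ncod (whisker C \<tau> K) = fcomp C G K"
    "ncomp (whisker C \<tau> K) \<in> extensional (Obj C)"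
    using \<tau> by (auto simp: whisker_def)
  show "ncomp (whisker C \<tau> K) X \<in> hom E (fobj (fcomp C F K) X) (fobj (fcomp C G K) X)"
    if "X \<in> Obj C" for X
    using that \<tau>(6) K(1) by (simp add: whisker_def fcomp_def)
  show "ncomp (whisker C \<tau> K) Y \<cdot>\<^bsub>E\<^esub> farr (fcomp C F K) f =
      farr (fcomp C G K) f \<cdot>\<^bsub>E\<^esub> ncomp (whisker C \<tau> K) X" if "f \<in> hom C X Y" for X Y f
    using that \<tau>(7)[OF K(2)] hom_ObjD[OF assms(1)] by (simp add: whisker_def fcomp_def)
qed

lemma const_functor_is_functor:
  assumes "category J" "category C" "X \<in> Obj C"
  shows "is_functor J C (const_functor J C X)"
proof -
  interpret J: category J by fact
  interpret C: category C by fact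
  show ?thesis
    unfolding is_functor_def const_functor_def
    using assms(3) hom_ObjD(3)[OF assms(1) J.Id_in_hom] hom_ObjD[OF assms(1)] hom_ObjD[OF assms(1) J.Comp_in_hom]
      C.Id_in_hom[OF assms(3)] hom_ObjD[OF assms(2) C.Id_in_hom] C.Comp_Id[OF C.Id_in_hom]
    by (auto simp: PiE_def)
qed


section \<open>Posets as categories\<close>

lemma poset_cat_simps [simp]:
  "Obj (poset_cat P) = carrier P"
  "(y, z) \<in> hom (poset_cat P) a b \<longleftrightarrow> y = a \<and> z = b \<and> a \<in> carrier P \<and> b \<in> carrier P \<and> a \<sqsubseteq>\<^bsub>P\<^esub> b"
  "(y, z) \<in> Arr (poset_cat P) \<longleftrightarrow> y \<in> carrier P \<and> z \<in> carrier P \<and> y \<sqsubseteq>\<^bsub>P\<^esub> z"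
  "Id (poset_cat P) y = (y, y)"
  "(b, d) \<cdot>\<^bsub>poset_cat P\<^esub> (a, c) = (a, d)"
  by (auto simp: poset_cat_def hom_def)

lemma in_hom_poset_cat:
  "f \<in> hom (poset_cat P) a b \<longleftrightarrow> f = (a, b) \<and> a \<in> carrier P \<and> b \<in> carrier P \<and> a \<sqsubseteq>\<^bsub>P\<^esub> b"
  by (cases f) auto

lemma nat_poset_simps [simp]: "carrier nat_poset = UNIV" "i \<sqsubseteq>\<^bsub>nat_poset\<^esub> j \<longleftrightarrow> i \<le> j"
  by (auto simp: nat_poset_def)

text \<open>Hypotheses in this bare form cover the lattice, its truncations
  \<open>jdim_le P k\<close> and \<open>nat_poset\<close> at once.\<close>

lemma category_poset_cat:
  assumes "\<And>a. a \<in> carrier P \<Longrightarrow> a \<sqsubseteq>\<^bsub>P\<^esub> a"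
    and "\<And>a b c. a \<sqsubseteq>\<^bsub>P\<^esub> b \<Longrightarrow> b \<sqsubseteq>\<^bsub>P\<^esub> c \<Longrightarrow>
      a \<in> carrier P \<Longrightarrow> b \<in> carrier P \<Longrightarrow> c \<in> carrier P \<Longrightarrow> a \<sqsubseteq>\<^bsub>P\<^esub> c"
  shows "category (poset_cat P)"
  by unfold_locales
    (auto simp: in_hom_poset_cat intro: assms, auto simp: poset_cat_def)

lemma category_nat: "category (poset_cat nat_poset)"
  by (rule category_poset_cat) auto

text \<open>Reflexivity and transitivity of the order are read back from the category laws:
  identities and composites have to be arrows, and an arrow is a pair of comparable
  elements.\<close>

lemma is_functor_incl_poset:
  assumes "category (poset_cat A)" "carrier A \<subseteq> carrier P" "le A = le P"
  shows "is_functor (poset_cat A) (poset_cat P) (incl (poset_cat A))"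
proof -
  interpret category "poset_cat A" by fact
  have refl: "a \<sqsubseteq>\<^bsub>P\<^esub> a" if "a \<in> carrier A" for a
    using Id_in_hom[of a] that assms(3) by simp
  have trans: "a \<sqsubseteq>\<^bsub>P\<^esub> c" if "a \<sqsubseteq>\<^bsub>P\<^esub> b" "b \<sqsubseteq>\<^bsub>P\<^esub> c" "a \<in> carrier A" "b \<in> carrier A" "c \<in> carrier A"
    for a b c
    using Comp_in_hom[of "(a, b)" a b "(b, c)" c] that assms(3) by simp
  show ?thesis
    using assms(2,3) refl trans
    unfolding is_functor_def incl_def by (auto simp: in_hom_poset_cat)
qed

text \<open>The functor with value \<open>Dom p\<close> on the lower set \<open>A\<close>, \<open>Cod p\<close> on the rest of the lower set
  \<open>B \<supseteq> A\<close> and the terminal object \<open>t\<close> elsewhere. For \<open>p = Id C Z\<close> and \<open>B\<close> the principal ideal of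
  \<open>x\<close> it is cofree: maps from \<open>H\<close> into it are maps \<open>H x \<rightarrow> Z\<close>.\<close>

definition step_functor ::
  "('p, 'l) gorder_scheme \<Rightarrow> ('o, 'a, 'm) cat_scheme \<Rightarrow> 'p set \<Rightarrow> 'p set \<Rightarrow> 'a \<Rightarrow> 'o \<Rightarrow>
   ('p, 'p \<times> 'p, 'o, 'a) ftor" where
  "step_functor P C A B p t =
     (let ob = (\<lambda>y. if y \<in> A then Dom C p else if y \<in> B then Cod C p else t) in
      \<lparr>fobj = (\<lambda>y \<in> carrier P. ob y),
       farr = (\<lambda>(y, z) \<in> Arr (poset_cat P).
         if z \<in> A then Id C (Dom C p)
         else if z \<in> B then (if y \<in> A then p else Id C (Cod C p))
         else (THE f. f \<in> hom C (ob y) t))\<rparr>)"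

text \<open>Outside the lower set a step functor must put no condition on the maps into it. A
  terminal value achieves this: there is exactly one component, and every naturality square ending
  there commutes.\<close>

definition is_terminal :: "('o, 'a, 'm) cat_scheme \<Rightarrow> 'o \<Rightarrow> bool" where
  "is_terminal C t \<longleftrightarrow> t \<in> Obj C \<and> (\<forall>X \<in> Obj C. \<exists>!f. f \<in> hom C X t)"

lemma is_terminal_the:
  assumes "is_terminal C t" "X \<in> Obj C"
  shows "(THE f. f \<in> hom C X t) \<in> hom C X t"
proof -
  have "\<exists>!f. f \<in> hom C X t"
    using assms unfolding is_terminal_def by blast
  then show ?thesis by (rule theI')
qed

lemma is_terminal_eq:
  assumes "category C" "is_terminal C t" "f \<in> hom C X t" "g \<in> hom C X t"
  shows "f = g"
proof -
  have "\<exists>!f. f \<in> hom C X t"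
    using assms(2) hom_ObjD(1)[OF assms(1,3)] unfolding is_terminal_def by blast
  then show ?thesis using assms(3,4) by blast
qed

text \<open>Since \<open>A\<close> and \<open>B\<close> are lower sets, arrows of the poset lead
  only from the \<open>X\<close> region to the \<open>Y\<close> region to the \<open>t\<close>
  region, never back. This is why a single arrow \<open>p\<close> determines a functor and no
  relation on \<open>p\<close> has to be imposed.\<close>

locale step_functor_data = C: category C + P: category "poset_cat P"
  for P :: "('p, 'l) gorder_scheme" and C :: "('o, 'a, 'm) cat_scheme" +
  fixes A B :: "'p set" and p :: 'a and X Y t :: 'o
  assumes p: "p \<in> hom C X Y"
    and t: "is_terminal C t"
    and sub: "A \<subseteq> B"
    and lowA: "\<And>y z. y \<in> carrier P \<Longrightarrow> z \<in> A \<Longrightarrow> y \<sqsubseteq>\<^bsub>P\<^esub> z \<Longrightarrow> y \<in> A"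
    and lowB: "\<And>y z. y \<in> carrier P \<Longrightarrow> z \<in> B \<Longrightarrow> y \<sqsubseteq>\<^bsub>P\<^esub> z \<Longrightarrow> y \<in> B"
begin

abbreviation "S \<equiv> step_functor P C A B p t"

lemma pXY [simp]: "Dom C p = X" "Cod C p = Y"
  using p by (auto simp: hom_def)

lemma obs: "X \<in> Obj C" "Y \<in> Obj C" "t \<in> Obj C"
  using hom_ObjD[OF C.category_axioms p] t by (auto simp: is_terminal_def)

lemma fobj_S:
  "y \<in> carrier P \<Longrightarrow> fobj S y = (if y \<in> A then X else if y \<in> B then Y else t)"
  by (simp add: step_functor_def)

lemma farr_S:
  assumes "y \<in> carrier P" "z \<in> carrier P" "y \<sqsubseteq>\<^bsub>P\<^esub> z"
  shows "z \<in> A \<Longrightarrow> farr S (y, z) = Id C X"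
    "z \<in> B \<Longrightarrow> z \<notin> A \<Longrightarrow> y \<in> A \<Longrightarrow> farr S (y, z) = p"
    "z \<in> B \<Longrightarrow> y \<notin> A \<Longrightarrow> farr S (y, z) = Id C Y"
    "z \<notin> B \<Longrightarrow> farr S (y, z) \<in> hom C (fobj S y) t"
proof -
  show "z \<in> A \<Longrightarrow> farr S (y, z) = Id C X"
    "z \<in> B \<Longrightarrow> z \<notin> A \<Longrightarrow> y \<in> A \<Longrightarrow> farr S (y, z) = p"
    using assms by (auto simp: step_functor_def)
  show "z \<in> B \<Longrightarrow> y \<notin> A \<Longrightarrow> farr S (y, z) = Id C Y"
    using assms lowA[of y z] by (auto simp: step_functor_def)
  assume "z \<notin> B"
  then have "farr S (y, z) = (THE f. f \<in> hom C (fobj S y) t)"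
    using assms sub by (auto simp: step_functor_def)
  moreover have "fobj S y \<in> Obj C"
    using assms obs by (auto simp: fobj_S)
  ultimately show "farr S (y, z) \<in> hom C (fobj S y) t"
    by (simp only: is_terminal_the[OF t])
qed

lemma farr_S_in_hom:
  assumes "y \<in> carrier P" "z \<in> carrier P" "y \<sqsubseteq>\<^bsub>P\<^esub> z"
  shows "farr S (y, z) \<in> hom C (fobj S y) (fobj S z)"
proof -
  consider "z \<in> A" | "z \<in> B" "z \<notin> A" "y \<in> A" | "z \<in> B" "y \<notin> A" | "z \<notin> B" by blast
  then show ?thesis
  proof cases
    case 1
    then have "y \<in> A" using lowA assms by blast
    then have "fobj S y = X" "fobj S z = X" using 1 assms by (simp_all add: fobj_S)
    then show ?thesis
      using farr_S(1)[OF assms 1] C.Id_in_hom[OF obs(1)] by simp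
  next
    case 2
    then have "fobj S y = X" "fobj S z = Y" using assms by (simp_all add: fobj_S)
    then show ?thesis
      using farr_S(2)[OF assms 2] p by simp
  next
    case 3
    then have "z \<notin> A" "y \<in> B" using lowA lowB assms by blast+
    then have "fobj S y = Y" "fobj S z = Y" using 3 assms by (simp_all add: fobj_S)
    then show ?thesis
      using farr_S(3)[OF assms 3] C.Id_in_hom[OF obs(2)] by simp
  next
    case 4
    then have "z \<notin> A" using sub by blast
    then have "fobj S z = t" using 4 assms by (simp add: fobj_S)
    then show ?thesis using farr_S(4)[OF assms 4] by simp
  qed
qed

lemma functor_S: "is_functor (poset_cat P) C S"
proof -
  have refl: "a \<sqsubseteq>\<^bsub>P\<^esub> a" if "a \<in> carrier P" for a
    using P.Id_in_hom[of a] that by simp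
  have trans: "a \<sqsubseteq>\<^bsub>P\<^esub> c" if "a \<sqsubseteq>\<^bsub>P\<^esub> b" "b \<sqsubseteq>\<^bsub>P\<^esub> c" "a \<in> carrier P" "b \<in> carrier P" "c \<in> carrier P"
    for a b c
    using P.Comp_in_hom[of "(a, b)" a b "(b, c)" c] that by simp
  have ob: "fobj S y \<in> Obj C" if "y \<in> carrier P" for y
    using that obs by (simp add: fobj_S)
  have arr: "farr S (y, z) \<in> Arr C" if "y \<in> carrier P" "z \<in> carrier P" "y \<sqsubseteq>\<^bsub>P\<^esub> z" for y z
    using farr_S_in_hom[OF that] by (simp add: hom_def)
  have idt: "farr S (y, y) = Id C (fobj S y)" if y: "y \<in> carrier P" for y
  proof -
    consider "y \<in> A" | "y \<in> B" "y \<notin> A" | "y \<notin> B" by blast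
    then show ?thesis
    proof cases
      case 1 then show ?thesis using farr_S(1)[OF y y refl[OF y]] y by (simp add: fobj_S)
    next
      case 2 then show ?thesis using farr_S(3)[OF y y refl[OF y]] y by (simp add: fobj_S)
    next
      case 3
      then have "y \<notin> A" using sub by auto
      with 3 show ?thesis
        using farr_S(4)[OF y y refl[OF y] 3] y C.Id_in_hom[OF obs(3)]
          is_terminal_eq[OF C.category_axioms t] by (simp add: fobj_S)
    qed
  qed
  have comp: "farr S (a, c) = farr S (b, c) \<cdot>\<^bsub>C\<^esub> farr S (a, b)"
    if le: "a \<sqsubseteq>\<^bsub>P\<^esub> b" "b \<sqsubseteq>\<^bsub>P\<^esub> c" and in_P: "a \<in> carrier P" "b \<in> carrier P" "c \<in> carrier P" for a b c
  proof -
    note ac = trans[OF le in_P]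
    note h = farr_S_in_hom[OF in_P(1,2) le(1)] farr_S_in_hom[OF in_P(2,3) le(2)]
      farr_S_in_hom[OF in_P(1,3) ac]
    \<comment> \<open>A chain that ends in \<open>B\<close> leaves \<open>A\<close> at most once, so
      at most one of the two factors is \<open>p\<close> and the other is an identity. Outside
      \<open>B\<close> both sides are maps to the terminal object.\<close>
    consider "c \<in> A" | "c \<in> B" "c \<notin> A" "b \<in> A" | "c \<in> B" "b \<notin> A" | "c \<notin> B" by blast
    then show ?thesis
    proof cases
      case 1
      then have "b \<in> A" using lowA in_P le by blast
      then show ?thesis
        using 1 farr_S(1) le in_P ac C.Id_Comp[OF C.Id_in_hom[OF obs(1)]] by simp
    next
      case 2
      then have "a \<in> A" using lowA in_P le by blast
      then show ?thesis
        using 2 farr_S(1,2) le in_P ac C.Comp_Id[OF p] by simp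
    next
      case 3
      then have "c \<notin> A" "b \<in> B" using lowA[of b c] lowB[of b c] in_P le by auto
      then have "fobj S c = Y" "fobj S b = Y" using 3 in_P by (auto simp: fobj_S)
      moreover have "farr S (b, c) = Id C Y" using farr_S(3) 3 in_P le by blast
      moreover have "farr S (a, c) = farr S (a, b)"
      proof (cases "a \<in> A")
        case True
        then show ?thesis
          using farr_S(2)[OF in_P(1,3) ac] farr_S(2)[OF in_P(1,2) le(1)] 3 \<open>c \<notin> A\<close> \<open>b \<in> B\<close> by simp
      next
        case False
        then show ?thesis
          using farr_S(3)[OF in_P(1,3) ac] farr_S(3)[OF in_P(1,2) le(1)] 3 \<open>b \<in> B\<close> by simp
      qed
      ultimately show ?thesis using C.Id_Comp[OF h(1)] by simp
    next
      case 4
      then have "fobj S c = t" using in_P sub by (auto simp: fobj_S)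
      then show ?thesis
        using is_terminal_eq[OF C.category_axioms t] h(3) C.Comp_in_hom[OF h(1,2)] by simp
    qed
  qed
  have ext: "fobj S \<in> extensional (carrier P)" "farr S \<in> extensional (Arr (poset_cat P))"
    by (auto simp: step_functor_def)
  have "fobj S \<in> carrier P \<rightarrow>\<^sub>E Obj C" "farr S \<in> Arr (poset_cat P) \<rightarrow>\<^sub>E Arr C"
    using ob arr ext by (auto simp: PiE_def)
  moreover have "\<forall>y z. \<forall>f \<in> hom (poset_cat P) y z. farr S f \<in> hom C (fobj S y) (fobj S z)"
    using farr_S_in_hom by (simp add: in_hom_poset_cat)
  moreover have "\<forall>a b c. \<forall>f \<in> hom (poset_cat P) a b. \<forall>g \<in> hom (poset_cat P) b c.
      farr S (g \<cdot>\<^bsub>poset_cat P\<^esub> f) = farr S g \<cdot>\<^bsub>C\<^esub> farr S f"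
    using comp by (simp add: in_hom_poset_cat)
  ultimately show ?thesis
    unfolding is_functor_def using idt by simp
qed

text \<open>Naturality is only demanded for arrows ending in \<open>B\<close>, one hypothesis for
  each shape of arrow there; squares that end at \<open>t\<close> commute by uniqueness.\<close>

lemma in_hom_FunI:
  assumes F: "is_functor (poset_cat P) C F"
    and "ndom \<tau> = F" "ncod \<tau> = S" "ncomp \<tau> \<in> extensional (carrier P)"
    and c: "\<And>y. y \<in> carrier P \<Longrightarrow> ncomp \<tau> y \<in> hom C (fobj F y) (fobj S y)"
    and nA: "\<And>y z. y \<in> carrier P \<Longrightarrow> z \<in> carrier P \<Longrightarrow> z \<in> A \<Longrightarrow> y \<sqsubseteq>\<^bsub>P\<^esub> z \<Longrightarrow>
      ncomp \<tau> z \<cdot>\<^bsub>C\<^esub> farr F (y, z) = ncomp \<tau> y"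
    and npB: "\<And>y z. y \<in> carrier P \<Longrightarrow> z \<in> carrier P \<Longrightarrow> y \<in> A \<Longrightarrow> z \<in> B \<Longrightarrow> z \<notin> A \<Longrightarrow> y \<sqsubseteq>\<^bsub>P\<^esub> z \<Longrightarrow>
      ncomp \<tau> z \<cdot>\<^bsub>C\<^esub> farr F (y, z) = p \<cdot>\<^bsub>C\<^esub> ncomp \<tau> y"
    and nB: "\<And>y z. y \<in> carrier P \<Longrightarrow> z \<in> carrier P \<Longrightarrow> y \<notin> A \<Longrightarrow> z \<in> B \<Longrightarrow> z \<notin> A \<Longrightarrow> y \<sqsubseteq>\<^bsub>P\<^esub> z \<Longrightarrow>
      ncomp \<tau> z \<cdot>\<^bsub>C\<^esub> farr F (y, z) = ncomp \<tau> y"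
  shows "\<tau> \<in> hom (Fun (poset_cat P) C) F S"
proof (rule hom_FunI)
  show "is_functor (poset_cat P) C F" "ndom \<tau> = F" "ncod \<tau> = S" by fact+
  show "is_functor (poset_cat P) C S" by (rule functor_S)
  show "ncomp \<tau> \<in> extensional (Obj (poset_cat P))" using assms(4) by simp
  show "ncomp \<tau> y \<in> hom C (fobj F y) (fobj S y)" if "y \<in> Obj (poset_cat P)" for y
    using c that by simp
  show "ncomp \<tau> z \<cdot>\<^bsub>C\<^esub> farr F f = farr S f \<cdot>\<^bsub>C\<^esub> ncomp \<tau> y" if "f \<in> hom (poset_cat P) y z" for y z f
  proof -
    have f: "f = (y, z)" and yz: "y \<in> carrier P" "z \<in> carrier P" "y \<sqsubseteq>\<^bsub>P\<^esub> z"
      using that by (auto simp: in_hom_poset_cat)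
    have h: "farr F f \<in> hom C (fobj F y) (fobj F z)"
      using functorD(2)[OF F that] .
    consider "z \<in> A" | "z \<in> B" "z \<notin> A" "y \<in> A" | "z \<in> B" "z \<notin> A" "y \<notin> A" | "z \<notin> B" by blast
    then show ?thesis
    proof cases
      case 1
      then show ?thesis
        using nA[OF yz(1,2) 1 yz(3)] lowA[OF yz(1) 1 yz(3)] farr_S(1)[OF yz 1] c[OF yz(1)]
          C.Id_Comp yz(1) f by (simp add: fobj_S)
    next
      case 2
      then show ?thesis
        using npB[OF yz(1,2) 2(3,1,2) yz(3)] farr_S(2)[OF yz 2] f by simp
    next
      case 3
      then show ?thesis
        using nB[OF yz(1,2) 3(3,1,2) yz(3)] lowB[OF yz(1) 3(1) yz(3)] farr_S(3)[OF yz 3(1,3)]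
          c[OF yz(1)] C.Id_Comp yz(1) f by (simp add: fobj_S)
    next
      case 4
      then have "fobj S z = t" using yz sub by (auto simp: fobj_S)
      then show ?thesis
        using is_terminal_eq[OF C.category_axioms t, of _ "fobj F y"]
          C.Comp_in_hom[OF h c[OF yz(2)]] C.Comp_in_hom[OF c[OF yz(1)] farr_S_in_hom[OF yz]] f
        by simp
    qed
  qed
qed

end


section \<open>Model categories\<close>

context model_category
begin

text \<open>A terminal object is the limit of the empty diagram. Functors are extensional, so every
  constant functor on the empty category is \<open>D\<close> itself, and each object carries the
  same trivial cone.\<close>

lemma ex_terminal: "\<exists>t. is_terminal M t"
proof -
  define J :: "('u, 'u) cat" where
    "J = \<lparr>Obj = {}, Arr = {}, Dom = undefined, Cod = undefined, Id = undefined, Comp = undefined\<rparr>"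
  define D :: "('u, 'u, 'o, 'a) ftor" where "D = \<lparr>fobj = (\<lambda>_. undefined), farr = (\<lambda>_. undefined)\<rparr>"
  have J: "category J"
    by unfold_locales (auto simp: J_def hom_def)
  have D: "is_functor J M D"
    by (auto simp: is_functor_def J_def D_def hom_def)
  from small_limits[OF J D] obtain t \<pi> where *: "is_limit J M D t \<pi>" by blast
  have const: "const_functor J M X = D" for X
    by (auto simp: const_functor_def J_def D_def)
  have "\<lparr>ndom = D, ncod = D, ncomp = (\<lambda>_. undefined)\<rparr> \<in> hom (Fun J M) D D"
    using D by (intro hom_FunI) (auto simp: J_def hom_def)
  with * have "is_terminal M t"
    unfolding is_limit_def is_terminal_def const by (auto simp: J_def)
  then show ?thesis by blast
qed

lemma Weq_retract: "is_retract M f g \<Longrightarrow> f \<in> Arr M \<Longrightarrow> g \<in> Weq M \<Longrightarrow> f \<in> Weq M"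
  using retracts(1) unfolding retract_closed_def by blast

text \<open>The axioms speak of identities only indirectly. Factoring the identity as
  \<open>p \<cdot> i\<close> with \<open>p\<close> an acyclic fibration exhibits it as a retract of
  \<open>p\<close>, with section \<open>i\<close> on domains and identities on codomains.\<close>

lemma Id_Fib_Weq:
  assumes "X \<in> Obj M"
  shows "Id M X \<in> Fib M \<inter> Weq M"
proof -
  note X = Id_in_hom[OF assms]
  obtain Z i p where ip: "i \<in> hom M X Z" "p \<in> hom M Z X" "p \<in> Fib M" "p \<in> Weq M" "Id M X = p \<cdot> i"
    using factor_cof_acyclic_fib[OF X] by blast
  have d: "Dom M (Id M X) = X" "Cod M (Id M X) = X" "Dom M p = Z" "Cod M p = X" "Id M X \<in> Arr M"
    using X ip by (auto simp: hom_def)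
  have "is_retract M (Id M X) p"
    unfolding is_retract_def d
    using ip X Comp_Id[OF X] Id_Comp[OF ip(2)]
    by (intro bexI[of _ i] bexI[of _ p] bexI[of _ "Id M X"]) auto
  then show ?thesis
    using retracts d(5) ip unfolding retract_closed_def by blast
qed

text \<open>An isomorphism is a retract of the identity of its domain: use identities on domains,
  and \<open>g\<close> followed by \<open>f\<close> on codomains.\<close>

lemma iso_Weq:
  assumes f: "f \<in> hom M X Y" and g: "g \<in> hom M Y X" and fg: "g \<cdot> f = Id M X" "f \<cdot> g = Id M Y"
  shows "f \<in> Weq M"
proof -
  have X: "X \<in> Obj M" using hom_ObjD[OF category_axioms f] by simp
  note I = Id_in_hom[OF X]
  have d: "Dom M f = X" "Cod M f = Y" "Dom M (Id M X) = X" "Cod M (Id M X) = X" "f \<in> Arr M"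
    using f I by (auto simp: hom_def)
  have "is_retract M f (Id M X)"
    unfolding is_retract_def d
    using f g fg I Comp_Id[OF I] Comp_Id[OF f] Id_Comp[OF f]
    by (intro bexI[of _ "Id M X"] bexI[of _ f] bexI[of _ g]) auto
  then show ?thesis
    using Weq_retract d(5) Id_Fib_Weq[OF X] by blast
qed

text \<open>The retract argument: if \<open>i\<close> lifts against the second factor of its own
  factorization, then it is a retract of the first factor.\<close>

lemma is_retract_if_lifting:
  assumes j: "j \<in> hom M X Z" and p: "p \<in> hom M Z Y" and i: "i \<in> hom M X Y" "i = p \<cdot> j"
    and h: "h \<in> hom M Y Z" "h \<cdot> i = j" "p \<cdot> h = Id M Y"
  shows "is_retract M i j"
proof -
  have X: "X \<in> Obj M" using hom_ObjD[OF category_axioms j] by simp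
  note I = Id_in_hom[OF X]
  have d: "Dom M i = X" "Cod M i = Y" "Dom M j = X" "Cod M j = Z"
    using i j by (auto simp: hom_def)
  show ?thesis
    unfolding is_retract_def d
    using h p i I Comp_Id[OF I] Comp_Id[OF j] Comp_Id[OF i(1)]
    by (intro bexI[of _ "Id M X"] bexI[of _ h] bexI[of _ p]) auto
qed

text \<open>Converse of the lifting axiom, by the retract argument for a factorization into a
  cofibration \<open>j\<close> and an acyclic fibration \<open>p\<close>.\<close>

lemma Cof_if_lifting:
  assumes i: "i \<in> hom M X Y"
    and lift: "\<And>p. p \<in> Fib M \<inter> Weq M \<Longrightarrow> has_lifting M i p"
  shows "i \<in> Cof M"
proof -
  obtain Z j p where jp: "j \<in> hom M X Z" "j \<in> Cof M" "p \<in> hom M Z Y" "p \<in> Fib M \<inter> Weq M" "i = p \<cdot> j"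
    using factor_cof_acyclic_fib[OF i] by blast
  have Y: "Y \<in> Obj M" using hom_ObjD[OF category_axioms i] by simp
  have d: "Dom M i = X" "Cod M i = Y" "Dom M p = Z" "Cod M p = Y" "i \<in> Arr M"
    using i jp by (auto simp: hom_def)
  have "p \<cdot> j = Id M Y \<cdot> i" using jp Id_Comp[OF i] by simp
  then obtain h where "h \<in> hom M Y Z" "h \<cdot> i = j" "p \<cdot> h = Id M Y"
    using lift[OF jp(4)] jp(1) Id_in_hom[OF Y] unfolding has_lifting_def d by blast
  then have "is_retract M i j"
    using is_retract_if_lifting[OF jp(1,3) i jp(5)] by blast
  then show ?thesis
    using retracts(3) jp(2) d(5) unfolding retract_closed_def by blast
qed

text \<open>The same argument with \<open>j\<close> an acyclic cofibration. It suits maps into a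
  colimit, because lifts out of a colimit can be assembled from its stages.\<close>

lemma Weq_if_lifting:
  assumes i: "i \<in> hom M X Y"
    and lift: "\<And>p. p \<in> Fib M \<Longrightarrow> has_lifting M i p"
  shows "i \<in> Weq M"
proof -
  obtain Z j p where jp: "j \<in> hom M X Z" "j \<in> Weq M" "p \<in> hom M Z Y" "p \<in> Fib M" "i = p \<cdot> j"
    using factor_acyclic_cof_fib[OF i] by blast
  have Y: "Y \<in> Obj M" using hom_ObjD[OF category_axioms i] by simp
  have d: "Dom M i = X" "Cod M i = Y" "Dom M p = Z" "Cod M p = Y" "i \<in> Arr M"
    using i jp by (auto simp: hom_def)
  have "p \<cdot> j = Id M Y \<cdot> i" using jp Id_Comp[OF i] by simp
  then obtain h where "h \<in> hom M Y Z" "h \<cdot> i = j" "p \<cdot> h = Id M Y"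
    using lift[OF jp(4)] jp(1) Id_in_hom[OF Y] unfolding has_lifting_def d by blast
  then have "is_retract M i j"
    using is_retract_if_lifting[OF jp(1,3) i jp(5)] by blast
  then show ?thesis
    using Weq_retract jp(2) d(5) by blast
qed

end

section \<open>Lifting properties of projectively cofibrant functors\<close>

lemma hom_proj_model: "hom (proj_model C M) = hom (Fun C M)"
  by (auto simp: hom_def proj_model_def fun_eq_iff)

text \<open>\<open>Cof\<close> of \<open>proj_model\<close> is itself a lifting property against
  objectwise acyclic fibrations, so it applies directly to the map from the initial functor to
  \<open>R\<close>. The required square starts at the initial functor and therefore
  commutes.\<close>

lemma cofibrant_lifting:
  assumes "category C" "category M" "cofibrant (proj_model C M) R"
    and \<pi>: "\<pi> \<in> hom (Fun C M) G H" and acyc: "\<And>X. X \<in> Obj C \<Longrightarrow> ncomp \<pi> X \<in> Fib M \<inter> Weq M"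
    and v: "v \<in> hom (Fun C M) R H"
  shows "\<exists>h \<in> hom (Fun C M) R G. \<pi> \<cdot>\<^bsub>Fun C M\<^esub> h = v"
proof -
  obtain I f where I: "is_initial (proj_model C M) I" and f: "f \<in> hom (Fun C M) I R"
    and cof: "f \<in> Cof (proj_model C M)"
    using assms(3) unfolding cofibrant_def hom_proj_model by blast
  have init: "\<exists>!u. u \<in> hom (Fun C M) I K" if "is_functor C M K" for K
    using I that unfolding is_initial_def hom_proj_model by (simp add: proj_model_def Fun_def)
  have "is_functor C M G" "is_functor C M H"
    using hom_FunD(1,2)[OF \<pi>] by auto
  then obtain u where u: "u \<in> hom (Fun C M) I G" using init by blast
  have eq: "\<pi> \<cdot>\<^bsub>Fun C M\<^esub> u = v \<cdot>\<^bsub>Fun C M\<^esub> f"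
    using init[OF \<open>is_functor C M H\<close>] Comp_Fun_in_hom[OF assms(1,2) u \<pi>]
      Comp_Fun_in_hom[OF assms(1,2) f v] by blast
  have "\<pi> \<in> Arr (Fun C M)" using \<pi> by (simp add: hom_def)
  then have "has_lifting (Fun C M) f \<pi>"
    using cof acyc by (simp add: proj_model_def)
  moreover have "Dom (Fun C M) f = I" "Cod (Fun C M) f = R" "Dom (Fun C M) \<pi> = G" "Cod (Fun C M) \<pi> = H"
    using f \<pi> by (auto simp: hom_def)
  ultimately show ?thesis
    using u v eq unfolding has_lifting_def by metis
qed

lemma cofibrant_is_functor:
  assumes "cofibrant (proj_model C M) R"
  shows "is_functor C M R"
  using assms hom_FunD(2) unfolding cofibrant_def hom_proj_model by blast


section \<open>Telescopes\<close>

text \<open>The steps from \<open>n\<close> to \<open>Suc n\<close> generate all arrows of the poset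
  of natural numbers, so their squares can be pasted together.\<close>

lemma nat_functor_natural:
  assumes C: "category C" and F: "is_functor (poset_cat nat_poset) C F"
    and G: "is_functor (poset_cat nat_poset) C G"
    and t: "\<And>n. t n \<in> hom C (fobj F n) (fobj G n)"
    and step: "\<And>n. t (Suc n) \<cdot>\<^bsub>C\<^esub> farr F (n, Suc n) = farr G (n, Suc n) \<cdot>\<^bsub>C\<^esub> t n"
  shows "i \<le> j \<Longrightarrow> t j \<cdot>\<^bsub>C\<^esub> farr F (i, j) = farr G (i, j) \<cdot>\<^bsub>C\<^esub> t i"
proof (induction rule: dec_induct)
  interpret category C by fact
  case base
  show ?case
    using functorD(3)[OF F, of i] functorD(3)[OF G, of i] Comp_Id[OF t] Id_Comp[OF t] by simp
next
  interpret category C by fact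
  case (step j)
  let ?J = "poset_cat nat_poset"
  have arr: "(i, j) \<in> hom ?J i j" "(j, Suc j) \<in> hom ?J j (Suc j)"
    using step by auto
  note f = functorD(2)[OF F arr(1)] functorD(2)[OF F arr(2)]
  note g = functorD(2)[OF G arr(1)] functorD(2)[OF G arr(2)]
  have "t (Suc j) \<cdot>\<^bsub>C\<^esub> farr F (i, Suc j) = (t (Suc j) \<cdot>\<^bsub>C\<^esub> farr F (j, Suc j)) \<cdot>\<^bsub>C\<^esub> farr F (i, j)"
    using functorD(4)[OF F arr] Comp_assoc[OF f t] by simp
  also have "\<dots> = farr G (j, Suc j) \<cdot>\<^bsub>C\<^esub> (t j \<cdot>\<^bsub>C\<^esub> farr F (i, j))"
    using assms(5) Comp_assoc[OF f(1) t g(2)] by simp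
  also have "\<dots> = farr G (i, Suc j) \<cdot>\<^bsub>C\<^esub> t i"
    using functorD(4)[OF G arr] Comp_assoc[OF t g] step.IH by simp
  finally show ?case .
qed

lemma nat_cocone_in_hom:
  assumes C: "category C" and F: "is_functor (poset_cat nat_poset) C F" and X: "X \<in> Obj C"
    and \<kappa>: "ndom \<kappa> = F" "ncod \<kappa> = const_functor (poset_cat nat_poset) C X"
    and t: "\<And>n. ncomp \<kappa> n \<in> hom C (fobj F n) X"
    and step: "\<And>n. ncomp \<kappa> (Suc n) \<cdot>\<^bsub>C\<^esub> farr F (n, Suc n) = ncomp \<kappa> n"
  shows "\<kappa> \<in> hom (Fun (poset_cat nat_poset) C) F (const_functor (poset_cat nat_poset) C X)"
proof -
  interpret category C by fact
  let ?X = "const_functor (poset_cat nat_poset) C X"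
  note fX = const_functor_is_functor[OF category_nat C X]
  have t': "ncomp \<kappa> n \<in> hom C (fobj F n) (fobj ?X n)" for n
    using t by (simp add: const_functor_def)
  have "ncomp \<kappa> (Suc n) \<cdot>\<^bsub>C\<^esub> farr F (n, Suc n) = farr ?X (n, Suc n) \<cdot>\<^bsub>C\<^esub> ncomp \<kappa> n" for n
    using step Id_Comp[OF t] by (simp add: const_functor_def)
  note nat = nat_functor_natural[OF C F fX t' this]
  show ?thesis
    by (rule hom_FunI) (use F fX \<kappa> t' nat in \<open>auto simp: in_hom_poset_cat\<close>)
qed

context model_category
begin

text \<open>A lifting problem for the single arrow \<open>farr R (n, Suc n)\<close> against
  \<open>p\<close> is encoded as a lifting problem for the whole functor \<open>R\<close> against an
  objectwise acyclic fibration, which projective cofibrancy solves.\<close>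

lemma cofibrant_telescope_Cof:
  assumes cof: "cofibrant (proj_model (poset_cat nat_poset) M) R"
  shows "farr R (n, Suc n) \<in> Cof M"
proof (rule Cof_if_lifting)
  let ?J = "poset_cat nat_poset"
  note fR = cofibrant_is_functor[OF cof]
  have R_arr: "farr R (i, j) \<in> hom M (fobj R i) (fobj R j)" if "i \<le> j" for i j
    using functorD(2)[OF fR, of "(i, j)" i j] that by simp
  have R_comp: "farr R (j, k) \<cdot> farr R (i, j) = farr R (i, k)" if "i \<le> j" "j \<le> k" for i j k
    using functorD(4)[OF fR, of "(i, j)" i j "(j, k)" k] that by simp
  have R_obj: "fobj R i \<in> Obj M" for i using functorD(1)[OF fR] by simp
  let ?r = "farr R (n, Suc n)"
  show r: "?r \<in> hom M (fobj R n) (fobj R (Suc n))" using R_arr by simp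
  fix p assume p_acyc: "p \<in> Fib M \<inter> Weq M"
  define E where "E = Dom M p"
  define B where "B = Cod M p"
  have p: "p \<in> hom M E B" using p_acyc Fib_subset by (auto simp: hom_def E_def B_def)
  have E: "E \<in> Obj M" using hom_ObjD[OF category_axioms p] by simp
  obtain t where t: "is_terminal M t" using ex_terminal by blast
  show "has_lifting M ?r p"
    unfolding has_lifting_def
  proof (intro ballI impI)
    fix u v
    assume "u \<in> hom M (Dom M ?r) (Dom M p)" and "v \<in> hom M (Cod M ?r) (Cod M p)"
      and sq: "p \<cdot> u = v \<cdot> ?r"
    then have u: "u \<in> hom M (fobj R n) E" and v: "v \<in> hom M (fobj R (Suc n)) B"
      using r by (auto simp: hom_def E_def B_def)
    \<comment> \<open>Up to stage \<open>Suc n\<close>, \<open>?G\<close> is constant at the domain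
      \<open>E\<close> of \<open>p\<close>, while \<open>?H\<close> moves from \<open>E\<close> to
      the codomain \<open>B\<close> along \<open>p\<close> at the last step. Both are terminal
      afterwards. The obvious map \<open>\<pi>\<close> between them is \<open>p\<close> at
      \<open>Suc n\<close> and an identity everywhere else.\<close>
    let ?G = "step_functor nat_poset M {..Suc n} {..Suc n} (Id M E) t"
    let ?H = "step_functor nat_poset M {..n} {..Suc n} p t"
    interpret G: step_functor_data nat_poset M "{..Suc n}" "{..Suc n}" "Id M E" E E t
      by (intro step_functor_data.intro step_functor_data_axioms.intro category_nat category_axioms t)
        (auto intro: Id_in_hom E)
    interpret H: step_functor_data nat_poset M "{..n}" "{..Suc n}" p E B t
      by (intro step_functor_data.intro step_functor_data_axioms.intro category_nat category_axioms t p)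
        auto
    have Suc_iff: "i \<le> Suc n \<and> \<not> i \<le> n \<longleftrightarrow> i = Suc n" for i by auto
    define \<pi> where "\<pi> = \<lparr>ndom = ?G, ncod = ?H,
      ncomp = (\<lambda>i. if i \<le> n then Id M E else if i = Suc n then p else Id M t)\<rparr>"
    have \<pi>: "\<pi> \<in> hom (Fun ?J M) ?G ?H"
    proof (rule H.in_hom_FunI[OF G.functor_S])
      show "ncomp \<pi> y \<in> hom M (fobj ?G y) (fobj ?H y)" for y
        using Id_in_hom[OF E] Id_in_hom[OF G.obs(3)] p
        by (auto simp: \<pi>_def G.fobj_S H.fobj_S)
    qed (use G.farr_S(1) Comp_Id[OF Id_in_hom[OF E]] Comp_Id[OF p] in
          \<open>auto simp: \<pi>_def extensional_def Suc_iff le_Suc_eq\<close>)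
    have acyc: "ncomp \<pi> i \<in> Fib M \<inter> Weq M" for i
      using p_acyc Id_Fib_Weq[OF E] Id_Fib_Weq[OF G.obs(3)] by (simp add: \<pi>_def)
    \<comment> \<open>The transpose of the square \<open>(u, v)\<close>: stages up to
      \<open>n\<close> go through \<open>u\<close>, stage \<open>Suc n\<close> is \<open>v\<close>,
      and \<open>sq\<close> is exactly naturality between \<open>n\<close> and
      \<open>Suc n\<close>.\<close>
    define w where "w = \<lparr>ndom = R, ncod = ?H,
      ncomp = (\<lambda>i. if i \<le> n then u \<cdot> farr R (i, n) else if i = Suc n then v
                   else (THE f. f \<in> hom M (fobj R i) t))\<rparr>"
    have w: "w \<in> hom (Fun ?J M) R ?H"
    proof (rule H.in_hom_FunI[OF fR])
      show "ncomp w y \<in> hom M (fobj R y) (fobj ?H y)" for y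
        using Comp_in_hom[OF R_arr u, of y] v is_terminal_the[OF t R_obj, of y]
        by (auto simp: w_def H.fobj_S)
      show "ncomp w z \<cdot> farr R (y, z) = ncomp w y" if "z \<in> {..n}" "y \<sqsubseteq>\<^bsub>nat_poset\<^esub> z" for y z
        using that Comp_assoc[OF R_arr R_arr u, of y z] R_comp[of y z n] by (simp add: w_def)
      show "ncomp w z \<cdot> farr R (y, z) = p \<cdot> ncomp w y"
        if "y \<in> {..n}" "z \<in> {..Suc n}" "z \<notin> {..n}" for y z
      proof -
        have z: "z = Suc n" and y: "y \<le> n" using that by auto
        have "v \<cdot> farr R (y, Suc n) = v \<cdot> ?r \<cdot> farr R (y, n)"
          using Comp_assoc[OF R_arr r v, of y] R_comp[of y n "Suc n"] y by simp
        also have "\<dots> = p \<cdot> (u \<cdot> farr R (y, n))"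
          using Comp_assoc[OF R_arr u p, of y] y sq by simp
        finally show ?thesis using z y by (simp add: w_def)
      qed
      show "ncomp w z \<cdot> farr R (y, z) = ncomp w y"
        if "y \<notin> {..n}" "z \<in> {..Suc n}" "y \<sqsubseteq>\<^bsub>nat_poset\<^esub> z" for y z
      proof -
        have "y = Suc n" "z = Suc n" using that by auto
        then show ?thesis
          using functorD(3)[OF fR, of "Suc n"] Comp_Id[OF v] by (simp add: w_def)
      qed
    qed (auto simp: w_def)
    obtain h where h: "h \<in> hom (Fun ?J M) R ?G" and \<pi>h: "\<pi> \<cdot>\<^bsub>Fun ?J M\<^esub> h = w"
      using cofibrant_lifting[OF category_nat category_axioms cof \<pi> acyc w] by blast
    have \<pi>h': "ncomp \<pi> i \<cdot> ncomp h i = ncomp w i" for i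
      unfolding \<pi>h[symmetric] by (simp add: ncomp_Comp_Fun)
    have h_hom: "ncomp h n \<in> hom M (fobj R n) E" "ncomp h (Suc n) \<in> hom M (fobj R (Suc n)) E"
      using hom_FunD(6)[OF h, of n] hom_FunD(6)[OF h, of "Suc n"] by (simp_all add: G.fobj_S)
    have "ncomp h n = u"
      using \<pi>h'[of n] Id_Comp[OF h_hom(1)] functorD(3)[OF fR, of n] Comp_Id[OF u]
      by (simp add: \<pi>_def w_def)
    moreover have "p \<cdot> ncomp h (Suc n) = v"
      using \<pi>h'[of "Suc n"] by (simp add: \<pi>_def w_def)
    \<comment> \<open>\<open>?G\<close> is constant across this step, so naturality of
      \<open>h\<close> is the upper triangle of the lift.\<close>
    moreover have "ncomp h (Suc n) \<cdot> ?r = ncomp h n"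
      using hom_FunD(7)[OF h, of "(n, Suc n)" n "Suc n"] G.farr_S(1)[of n "Suc n"] Id_Comp[OF h_hom(1)]
      by simp
    ultimately show "\<exists>h \<in> hom M (Cod M ?r) (Dom M p). h \<cdot> ?r = u \<and> p \<cdot> h = v"
      using h_hom(2) r by (auto simp: hom_def)
  qed
qed

text \<open>A lift out of the colimit \<open>L\<close> is a cocone on \<open>R\<close>. It can start
  as \<open>u\<close> at stage \<open>k\<close> and be extended one acyclic cofibration at a time,
  whatever the arrows before \<open>k\<close> are.\<close>

lemma telescope_colimit_Weq:
  assumes fR: "is_functor (poset_cat nat_poset) M R"
    and colim: "is_colimit (poset_cat nat_poset) M R L \<iota>"
    and acyc: "\<And>n. n \<ge> k \<Longrightarrow> farr R (n, Suc n) \<in> Cof M \<inter> Weq M"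
  shows "ncomp \<iota> k \<in> Weq M"
proof (rule Weq_if_lifting)
  let ?J = "poset_cat nat_poset"
  have R_arr: "farr R (i, j) \<in> hom M (fobj R i) (fobj R j)" if "i \<le> j" for i j
    using functorD(2)[OF fR, of "(i, j)" i j] that by simp
  have R_comp: "farr R (j, m) \<cdot> farr R (i, j) = farr R (i, m)" if "i \<le> j" "j \<le> m" for i j m
    using functorD(4)[OF fR, of "(i, j)" i j "(j, m)" m] that by simp
  have L: "L \<in> Obj M" and \<iota>: "\<iota> \<in> hom (Fun ?J M) R (const_functor ?J M L)"
    and univ: "\<And>X \<kappa>. X \<in> Obj M \<Longrightarrow> \<kappa> \<in> hom (Fun ?J M) R (const_functor ?J M X) \<Longrightarrow>
      \<exists>!u. u \<in> hom M L X \<and> (\<forall>j. u \<cdot> ncomp \<iota> j = ncomp \<kappa> j)"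
    using colim unfolding is_colimit_def by auto
  have \<iota>_hom: "ncomp \<iota> n \<in> hom M (fobj R n) L" for n
    using hom_FunD(6)[OF \<iota>, of n] by (simp add: const_functor_def)
  then show "ncomp \<iota> k \<in> hom M (fobj R k) L" .
  have \<iota>_step: "ncomp \<iota> (Suc n) \<cdot> farr R (n, Suc n) = ncomp \<iota> n" for n
    using hom_FunD(7)[OF \<iota>, of "(n, Suc n)" n "Suc n"] Id_Comp[OF \<iota>_hom]
    by (simp add: const_functor_def)
  fix p assume pF: "p \<in> Fib M"
  define E where "E = Dom M p"
  define B where "B = Cod M p"
  have p: "p \<in> hom M E B" using pF Fib_subset by (auto simp: hom_def E_def B_def)
  have E: "E \<in> Obj M" and B: "B \<in> Obj M" using hom_ObjD[OF category_axioms p] by auto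
  show "has_lifting M (ncomp \<iota> k) p"
    unfolding has_lifting_def
  proof (intro ballI impI)
    fix u v
    assume "u \<in> hom M (Dom M (ncomp \<iota> k)) (Dom M p)" and "v \<in> hom M (Cod M (ncomp \<iota> k)) (Cod M p)"
      and sq: "p \<cdot> u = v \<cdot> ncomp \<iota> k"
    then have u: "u \<in> hom M (fobj R k) E" and v: "v \<in> hom M L B"
      using \<iota>_hom[of k] by (auto simp: hom_def E_def B_def)
    \<comment> \<open>Indices are shifted by \<open>k\<close>. The last conjunct pins the start of
      the sequence to \<open>u\<close>, which the bare choice principle would not record.\<close>
    let ?P = "\<lambda>n h. h \<in> hom M (fobj R (k + n)) E \<and> p \<cdot> h = v \<cdot> ncomp \<iota> (k + n) \<and> (n = 0 \<longrightarrow> h = u)"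
    have "\<exists>h. \<forall>n. ?P n (h n) \<and> h (Suc n) \<cdot> farr R (k + n, Suc (k + n)) = h n"
    proof (rule dependent_nat_choice)
      show "\<exists>h. ?P 0 h" using u sq by auto
      fix h n assume "?P n h"
      then have h: "h \<in> hom M (fobj R (k + n)) E" and ph: "p \<cdot> h = v \<cdot> ncomp \<iota> (k + n)" by auto
      let ?r = "farr R (k + n, Suc (k + n))"
      have r: "?r \<in> hom M (fobj R (k + n)) (fobj R (Suc (k + n)))" using R_arr by simp
      have lift: "has_lifting M ?r p"
        using lifting_acyclic_cof_fib[OF acyc pF] by simp
      have d: "Dom M ?r = fobj R (k + n)" "Cod M ?r = fobj R (Suc (k + n))" "Dom M p = E" "Cod M p = B"
        using r p by (auto simp: hom_def)
      have "p \<cdot> h = (v \<cdot> ncomp \<iota> (Suc (k + n))) \<cdot> ?r"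
        using ph Comp_assoc[OF r \<iota>_hom v] \<iota>_step by simp
      then obtain h' where "h' \<in> hom M (fobj R (Suc (k + n))) E" "h' \<cdot> ?r = h"
          "p \<cdot> h' = v \<cdot> ncomp \<iota> (Suc (k + n))"
        using lift h Comp_in_hom[OF \<iota>_hom v] unfolding has_lifting_def d by blast
      then show "\<exists>h'. ?P (Suc n) h' \<and> h' \<cdot> ?r = h" by auto
    qed
    then obtain h where h: "\<And>n. h n \<in> hom M (fobj R (k + n)) E"
      and ph: "\<And>n. p \<cdot> h n = v \<cdot> ncomp \<iota> (k + n)" and h0: "h 0 = u"
      and h_step: "\<And>n. h (Suc n) \<cdot> farr R (k + n, Suc (k + n)) = h n"
      by metis
    \<comment> \<open>Before stage \<open>k\<close> the cocone is forced: it must factor through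
      \<open>u\<close> at stage \<open>k\<close>. The two clauses fit together because
      \<open>h 0 = u\<close>.\<close>
    define \<kappa> where "\<kappa> = \<lparr>ndom = R, ncod = const_functor ?J M E,
      ncomp = (\<lambda>n. if n < k then u \<cdot> farr R (n, k) else h (n - k))\<rparr>"
    have \<kappa>_hom: "ncomp \<kappa> n \<in> hom M (fobj R n) E" for n
      using h[of "n - k"] Comp_in_hom[OF R_arr u, of n] by (auto simp: \<kappa>_def)
    have \<kappa>_step: "ncomp \<kappa> (Suc n) \<cdot> farr R (n, Suc n) = ncomp \<kappa> n" for n
    proof -
      consider "Suc n < k" | "Suc n = k" | "n \<ge> k" by linarith
      then show ?thesis
      proof cases
        case 1
        then show ?thesis
          using Comp_assoc[OF R_arr R_arr u, of n "Suc n"] R_comp[of n "Suc n" k]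
          by (simp add: \<kappa>_def)
      next
        case 2
        then show ?thesis using h0 by (auto simp: \<kappa>_def)
      next
        case 3
        then show ?thesis using h_step[of "n - k"] by (simp add: \<kappa>_def Suc_diff_le)
      qed
    qed
    have \<kappa>: "\<kappa> \<in> hom (Fun ?J M) R (const_functor ?J M E)"
      by (rule nat_cocone_in_hom[OF category_axioms fR E _ _ \<kappa>_hom \<kappa>_step]) (simp_all add: \<kappa>_def)
    obtain g where g: "g \<in> hom M L E" and g\<iota>: "\<And>j. g \<cdot> ncomp \<iota> j = ncomp \<kappa> j"
      using univ[OF E \<kappa>] by blast
    have p\<kappa>: "p \<cdot> ncomp \<kappa> n = v \<cdot> ncomp \<iota> n" for n
    proof (cases "n < k")
      case True
      have "ncomp \<iota> k \<cdot> farr R (n, k) = ncomp \<iota> n"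
        using hom_FunD(7)[OF \<iota>, of "(n, k)" n k] Id_Comp[OF \<iota>_hom] True
        by (simp add: const_functor_def)
      then have "p \<cdot> (u \<cdot> farr R (n, k)) = v \<cdot> ncomp \<iota> n"
        using Comp_assoc[OF R_arr u p, of n] Comp_assoc[OF R_arr \<iota>_hom v, of n k] sq True by simp
      then show ?thesis using True by (simp add: \<kappa>_def)
    next
      case False
      then show ?thesis using ph[of "n - k"] by (simp add: \<kappa>_def)
    qed
    \<comment> \<open>Both \<open>p \<cdot> g\<close> and \<open>v\<close> induce this cocone, so
      uniqueness of maps out of \<open>L\<close> gives the lower triangle of the lift.\<close>
    define \<mu> where "\<mu> = \<lparr>ndom = R, ncod = const_functor ?J M B, ncomp = (\<lambda>n. v \<cdot> ncomp \<iota> n)\<rparr>"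
    have \<mu>: "\<mu> \<in> hom (Fun ?J M) R (const_functor ?J M B)"
    proof (rule nat_cocone_in_hom[OF category_axioms fR B])
      show "ncomp \<mu> n \<in> hom M (fobj R n) B" for n
        using Comp_in_hom[OF \<iota>_hom v] by (simp add: \<mu>_def)
      show "ncomp \<mu> (Suc n) \<cdot> farr R (n, Suc n) = ncomp \<mu> n" for n
        using Comp_assoc[OF R_arr \<iota>_hom v, of n "Suc n"] \<iota>_step by (simp add: \<mu>_def)
    qed (simp_all add: \<mu>_def)
    have "p \<cdot> g \<in> hom M L B \<and> (\<forall>j. p \<cdot> g \<cdot> ncomp \<iota> j = ncomp \<mu> j)"
      using Comp_in_hom[OF g p] Comp_assoc[OF \<iota>_hom g p] g\<iota> p\<kappa> by (simp add: \<mu>_def)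
    moreover have "v \<in> hom M L B \<and> (\<forall>j. v \<cdot> ncomp \<iota> j = ncomp \<mu> j)"
      using v by (simp add: \<mu>_def)
    ultimately have "p \<cdot> g = v" using univ[OF B \<mu>] by blast
    moreover have "g \<cdot> ncomp \<iota> k = u" using g\<iota>[of k] h0 by (simp add: \<kappa>_def)
    moreover have "Cod M (ncomp \<iota> k) = L" using \<iota>_hom by (auto simp: hom_def)
    ultimately show "\<exists>h \<in> hom M (Cod M (ncomp \<iota> k)) (Dom M p). h \<cdot> ncomp \<iota> k = u \<and> p \<cdot> h = v"
      using g unfolding E_def by blast
  qed
qed

end


section \<open>Kan extensions along full inclusions of posets\<close>

context model_category
begin

text \<open>The Kan extension is not assumed to be pointwise. Testing its universal property on cofree
  functors (\<open>Z\<close> below \<open>x\<close>, terminal elsewhere) shows that precomposition with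
  \<open>\<eta> x\<close> is a bijection \<open>Hom (T x) Z \<rightarrow> Hom (Q x) Z\<close> for every \<open>Z\<close>.\<close>

lemma kan_unit_Weq:
  assumes P: "category (poset_cat P)" and A: "category (poset_cat A)"
    and sub: "carrier A \<subseteq> carrier P" and le: "le A = le P"
    and kan: "is_left_kan_extension (poset_cat A) (poset_cat P) M (incl (poset_cat A)) Q T \<eta>"
    and x: "x \<in> carrier A"
  shows "ncomp \<eta> x \<in> Weq M"
proof -
  let ?A = "poset_cat A" and ?P = "poset_cat P"
  let ?K = "incl ?A"
  note K = is_functor_incl_poset[OF A sub le]
  have \<eta>: "\<eta> \<in> hom (Fun ?A M) Q (fcomp ?A T ?K)" and fT: "is_functor ?P M T"
    and univ: "\<And>G \<alpha>. is_functor ?P M G \<Longrightarrow> \<alpha> \<in> hom (Fun ?A M) Q (fcomp ?A G ?K) \<Longrightarrow>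
      \<exists>!\<beta>. \<beta> \<in> hom (Fun ?P M) T G \<and> whisker ?A \<beta> ?K \<cdot>\<^bsub>Fun ?A M\<^esub> \<eta> = \<alpha>"
    using kan unfolding is_left_kan_extension_def by (auto simp: Fun_def)
  note fQ = hom_FunD(1)[OF \<eta>]
  have xP: "x \<in> carrier P" using x sub by blast
  have refl: "x \<sqsubseteq>\<^bsub>P\<^esub> x" using category.Id_in_hom[OF P, of x] xP by simp
  have trans: "y \<sqsubseteq>\<^bsub>P\<^esub> x" if "y \<sqsubseteq>\<^bsub>P\<^esub> z" "z \<sqsubseteq>\<^bsub>P\<^esub> x" "y \<in> carrier P" "z \<in> carrier P" for y z
    using category.Comp_in_hom[OF P, of "(y, z)" y z "(z, x)" x] that xP by simp
  have \<eta>_hom: "ncomp \<eta> y \<in> hom M (fobj Q y) (fobj T y)" if "y \<in> carrier A" for y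
    using hom_FunD(6)[OF \<eta>] that by (simp add: fcomp_def incl_def)
  have Q_arr: "farr Q (y, z) \<in> hom M (fobj Q y) (fobj Q z)"
    if "y \<in> carrier A" "z \<in> carrier A" "y \<sqsubseteq>\<^bsub>P\<^esub> z" for y z
    using functorD(2)[OF fQ, of "(y, z)" y z] that le by simp
  have T_arr: "farr T (y, z) \<in> hom M (fobj T y) (fobj T z)"
    if "y \<in> carrier P" "z \<in> carrier P" "y \<sqsubseteq>\<^bsub>P\<^esub> z" for y z
    using functorD(2)[OF fT, of "(y, z)" y z] that by simp
  obtain t where t: "is_terminal M t" using ex_terminal by blast
  let ?B = "{y. y \<sqsubseteq>\<^bsub>P\<^esub> x \<and> y \<in> carrier P}"
  let ?G = "\<lambda>Z. step_functor P M ?B ?B (Id M Z) t"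
  have G: "step_functor_data P M ?B ?B (Id M Z) Z Z t" if "Z \<in> Obj M" for Z
    by (intro step_functor_data.intro step_functor_data_axioms.intro P category_axioms t
        Id_in_hom that) (use trans in auto)

  \<comment> \<open>Surjectivity of precomposition with the unit. The transpose
    \<open>\<alpha>\<close> of \<open>g\<close> sends \<open>y\<close> below \<open>x\<close>
    through \<open>Q x\<close> and then \<open>g\<close>; the universal property extends it to
    \<open>T\<close>, and its component at \<open>x\<close> is the wanted factorization.\<close>
  have ext: "\<exists>g' \<in> hom M (fobj T x) Z. g' \<cdot> ncomp \<eta> x = g" if g: "g \<in> hom M (fobj Q x) Z" for g Z
  proof -
    have Z: "Z \<in> Obj M" using hom_ObjD[OF category_axioms g] by simp
    interpret G: step_functor_data P M ?B ?B "Id M Z" Z Z t using G[OF Z] .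
    define \<alpha> where "\<alpha> = \<lparr>ndom = Q, ncod = fcomp ?A (?G Z) ?K,
      ncomp = (\<lambda>y \<in> carrier A. if y \<sqsubseteq>\<^bsub>P\<^esub> x then g \<cdot> farr Q (y, x) else (THE f. f \<in> hom M (fobj Q y) t))\<rparr>"
    have "\<alpha> \<in> hom (Fun ?A M) Q (fcomp ?A (?G Z) ?K)"
    proof (rule hom_FunI[OF fQ is_functor_fcomp[OF A K G.functor_S]])
      have \<alpha>_hom: "ncomp \<alpha> y \<in> hom M (fobj Q y) (fobj (?G Z) y)" if y: "y \<in> carrier A" for y
      proof -
        have "y \<in> carrier P" using sub y by blast
        then show ?thesis
          using Comp_in_hom[OF Q_arr g] x y is_terminal_the[OF t functorD(1)[OF fQ, of y]]
          by (simp add: \<alpha>_def G.fobj_S)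
      qed
      then show "ncomp \<alpha> y \<in> hom M (fobj Q y) (fobj (fcomp ?A (?G Z) ?K) y)" if "y \<in> Obj ?A" for y
        using that by (simp add: fcomp_def incl_def)
      fix y z f assume "f \<in> hom ?A y z"
      then have f: "f = (y, z)" and yz: "y \<in> carrier A" "z \<in> carrier A" and yz_le: "y \<sqsubseteq>\<^bsub>P\<^esub> z"
        using le by (auto simp: in_hom_poset_cat)
      have yzP: "y \<in> carrier P" "z \<in> carrier P" using yz sub by auto
      note q = Q_arr[OF yz yz_le]
      note s = G.farr_S_in_hom[OF yzP yz_le]
      have "ncomp \<alpha> z \<cdot> farr Q (y, z) = farr (?G Z) (y, z) \<cdot> ncomp \<alpha> y"
      proof (cases "z \<sqsubseteq>\<^bsub>P\<^esub> x")
        case True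
        then have yx: "y \<sqsubseteq>\<^bsub>P\<^esub> x" using trans yz_le yzP by blast
        have "g \<cdot> farr Q (z, x) \<cdot> farr Q (y, z) = g \<cdot> farr Q (y, x)"
          using Comp_assoc[OF q Q_arr g] functorD(4)[OF fQ, of "(y, z)" y z "(z, x)" x]
            True yz yz_le x le by simp
        then show ?thesis
          using G.farr_S(1)[OF yzP yz_le] True yx yz yzP Id_Comp[OF Comp_in_hom[OF Q_arr g]] x
          by (simp add: \<alpha>_def)
      next
        case False
        then have "fobj (?G Z) z = t" using yzP by (simp add: G.fobj_S)
        then show ?thesis
          using is_terminal_eq[OF category_axioms t, of _ "fobj Q y"]
            Comp_in_hom[OF q \<alpha>_hom[OF yz(2)]] Comp_in_hom[OF \<alpha>_hom[OF yz(1)] s] by simp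
      qed
      then show "ncomp \<alpha> z \<cdot> farr Q f = farr (fcomp ?A (?G Z) ?K) f \<cdot> ncomp \<alpha> y"
        using f yz yz_le le by (simp add: fcomp_def incl_def)
    qed (simp_all add: \<alpha>_def)
    then obtain \<beta> where \<beta>: "\<beta> \<in> hom (Fun ?P M) T (?G Z)"
      and eq: "whisker ?A \<beta> ?K \<cdot>\<^bsub>Fun ?A M\<^esub> \<eta> = \<alpha>"
      using univ[OF G.functor_S] by blast
    have "ncomp (whisker ?A \<beta> ?K \<cdot>\<^bsub>Fun ?A M\<^esub> \<eta>) x = ncomp \<beta> x \<cdot> ncomp \<eta> x"
      using x by (simp add: ncomp_Comp_Fun ncomp_whisker incl_def)
    moreover have "ncomp \<alpha> x = g"
      using x refl functorD(3)[OF fQ, of x] Comp_Id[OF g] by (simp add: \<alpha>_def)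
    moreover have "ncomp \<beta> x \<in> hom M (fobj T x) Z"
      using hom_FunD(6)[OF \<beta>, of x] xP refl by (simp add: G.fobj_S)
    ultimately show ?thesis using eq by auto
  qed

  \<comment> \<open>Injectivity. The transposes of \<open>g\<close> and \<open>g'\<close> have to
    agree after restriction along the unit at every \<open>y\<close> in the subposet. For
    \<open>y\<close> below \<open>x\<close>, naturality of \<open>\<eta>\<close> reduces this to the
    assumed equality at \<open>x\<close>; for other \<open>y\<close> the two components are the same
    map to \<open>t\<close>.\<close>
  have uniq: "g = g'" if g: "g \<in> hom M (fobj T x) Z" and g': "g' \<in> hom M (fobj T x) Z"
    and eq: "g \<cdot> ncomp \<eta> x = g' \<cdot> ncomp \<eta> x" for g g' Z
  proof -
    have Z: "Z \<in> Obj M" using hom_ObjD[OF category_axioms g] by simp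
    interpret G: step_functor_data P M ?B ?B "Id M Z" Z Z t using G[OF Z] .
    define \<beta> where "\<beta> = (\<lambda>g. \<lparr>ndom = T, ncod = ?G Z,
      ncomp = (\<lambda>y \<in> carrier P. if y \<sqsubseteq>\<^bsub>P\<^esub> x then g \<cdot> farr T (y, x) else (THE f. f \<in> hom M (fobj T y) t))\<rparr>)"
    have \<beta>: "\<beta> g \<in> hom (Fun ?P M) T (?G Z)" if g: "g \<in> hom M (fobj T x) Z" for g
    proof (rule G.in_hom_FunI[OF fT])
      show "ncomp (\<beta> g) y \<in> hom M (fobj T y) (fobj (?G Z) y)" if y: "y \<in> carrier P" for y
        using Comp_in_hom[OF T_arr g] xP y is_terminal_the[OF t functorD(1)[OF fT, of y]]
        by (simp add: \<beta>_def G.fobj_S)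
      show "ncomp (\<beta> g) z \<cdot> farr T (y, z) = ncomp (\<beta> g) y"
        if yz: "y \<in> carrier P" "z \<in> carrier P" "z \<in> ?B" "y \<sqsubseteq>\<^bsub>P\<^esub> z" for y z
      proof -
        have yx: "y \<sqsubseteq>\<^bsub>P\<^esub> x" using trans yz by blast
        have "g \<cdot> farr T (z, x) \<cdot> farr T (y, z) = g \<cdot> farr T (y, x)"
          using Comp_assoc[OF T_arr T_arr g, of y z] functorD(4)[OF fT, of "(y, z)" y z "(z, x)" x]
            yz xP by simp
        then show ?thesis using yz yx by (simp add: \<beta>_def)
      qed
    qed (simp_all add: \<beta>_def)
    have w: "whisker ?A (\<beta> g) ?K \<cdot>\<^bsub>Fun ?A M\<^esub> \<eta> \<in> hom (Fun ?A M) Q (fcomp ?A (?G Z) ?K)"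
      if g: "g \<in> hom M (fobj T x) Z" for g
      using Comp_Fun_in_hom[OF A category_axioms \<eta> whisker_in_hom[OF A K \<beta>[OF g]]] .
    have "whisker ?A (\<beta> g) ?K \<cdot>\<^bsub>Fun ?A M\<^esub> \<eta> = whisker ?A (\<beta> g') ?K \<cdot>\<^bsub>Fun ?A M\<^esub> \<eta>"
    proof (rule hom_Fun_eqI[OF w[OF g] w[OF g']])
      fix y assume y: "y \<in> Obj ?A"
      then have yP: "y \<in> carrier P" using sub by auto
      have "h \<cdot> farr T (y, x) \<cdot> ncomp \<eta> y = h \<cdot> ncomp \<eta> x \<cdot> farr Q (y, x)"
        if h: "h \<in> hom M (fobj T x) Z" and yx: "y \<sqsubseteq>\<^bsub>P\<^esub> x" for h
      proof -
        have "ncomp \<eta> x \<cdot> farr Q (y, x) = farr T (y, x) \<cdot> ncomp \<eta> y"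
          using hom_FunD(7)[OF \<eta>, of "(y, x)" y x] y x yx le by (simp add: fcomp_def incl_def)
        then show ?thesis
          using Comp_assoc[OF \<eta>_hom T_arr h, of y] Comp_assoc[OF Q_arr \<eta>_hom h, of y] y x yx yP xP
          by simp
      qed
      then have "ncomp (\<beta> g) y \<cdot> ncomp \<eta> y = ncomp (\<beta> g') y \<cdot> ncomp \<eta> y"
        using g g' eq yP by (simp add: \<beta>_def)
      then show "ncomp (whisker ?A (\<beta> g) ?K \<cdot>\<^bsub>Fun ?A M\<^esub> \<eta>) y =
          ncomp (whisker ?A (\<beta> g') ?K \<cdot>\<^bsub>Fun ?A M\<^esub> \<eta>) y"
        using y by (simp add: ncomp_Comp_Fun ncomp_whisker incl_def)
    qed
    then have "\<beta> g = \<beta> g'"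
      using univ[OF G.functor_S w[OF g']] \<beta>[OF g] \<beta>[OF g'] by blast
    then have "ncomp (\<beta> g) x = ncomp (\<beta> g') x" by simp
    then show ?thesis
      using xP refl functorD(3)[OF fT, of x] Comp_Id[OF g] Comp_Id[OF g'] by (simp add: \<beta>_def)
  qed

  note \<eta>x = \<eta>_hom[OF x]
  have ob: "fobj Q x \<in> Obj M" "fobj T x \<in> Obj M" using hom_ObjD[OF category_axioms \<eta>x] by auto
  \<comment> \<open>Surjectivity at the identity of \<open>Q x\<close> gives a left inverse of the
    unit component; injectivity then makes it a right inverse as well.\<close>
  obtain s where s: "s \<in> hom M (fobj T x) (fobj Q x)" "s \<cdot> ncomp \<eta> x = Id M (fobj Q x)"
    using ext[OF Id_in_hom[OF ob(1)]] by blast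
  have "ncomp \<eta> x \<cdot> s \<cdot> ncomp \<eta> x = Id M (fobj T x) \<cdot> ncomp \<eta> x"
    using Comp_assoc[OF \<eta>x s(1) \<eta>x] s(2) Comp_Id[OF \<eta>x] Id_Comp[OF \<eta>x] by simp
  then have "ncomp \<eta> x \<cdot> s = Id M (fobj T x)"
    by (rule uniq[OF Comp_in_hom[OF s(1) \<eta>x] Id_in_hom[OF ob(2)]])
  then show ?thesis by (rule iso_Weq[OF \<eta>x s])
qed

end

section \<open>Maps induced by the universal property of a Kan extension\<close>

lemma kan_induced_props:
  assumes "is_left_kan_extension C D E K Q T \<eta>" "is_functor D E G"
    and "\<alpha> \<in> hom (Fun C E) Q (fcomp C G K)"
  shows "kan_induced C D E K T \<eta> G \<alpha> \<in> hom (Fun D E) T G"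
    and "whisker C (kan_induced C D E K T \<eta> G \<alpha>) K \<cdot>\<^bsub>Fun C E\<^esub> \<eta> = \<alpha>"
proof -
  have "\<exists>!\<beta>. \<beta> \<in> hom (Fun D E) T G \<and> whisker C \<beta> K \<cdot>\<^bsub>Fun C E\<^esub> \<eta> = \<alpha>"
    using assms unfolding is_left_kan_extension_def by (simp add: Fun_def)
  from theI'[OF this]
  show "kan_induced C D E K T \<eta> G \<alpha> \<in> hom (Fun D E) T G"
    and "whisker C (kan_induced C D E K T \<eta> G \<alpha>) K \<cdot>\<^bsub>Fun C E\<^esub> \<eta> = \<alpha>"
    unfolding kan_induced_def by blast+
qed

lemma kan_induced_eqI:
  assumes "is_left_kan_extension C D E K Q T \<eta>" "is_functor D E G"
    and "\<alpha> \<in> hom (Fun C E) Q (fcomp C G K)"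
    and "\<beta> \<in> hom (Fun D E) T G" "whisker C \<beta> K \<cdot>\<^bsub>Fun C E\<^esub> \<eta> = \<alpha>"
  shows "kan_induced C D E K T \<eta> G \<alpha> = \<beta>"
proof -
  have "\<exists>!\<beta>. \<beta> \<in> hom (Fun D E) T G \<and> whisker C \<beta> K \<cdot>\<^bsub>Fun C E\<^esub> \<eta> = \<alpha>"
    using assms(1-3) unfolding is_left_kan_extension_def by (simp add: Fun_def)
  then show ?thesis
    using kan_induced_props[OF assms(1-3)] assms(4,5) by blast
qed


section \<open>Join-dimension\<close>

text \<open>A minimal counterexample \<open>m\<close> cannot be join-irreducible, since the
  singleton of \<open>m\<close> would decompose it. So \<open>m\<close> is a join of two strictly
  smaller elements, and the union of their decompositions decomposes \<open>m\<close>. The sets stay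
  nonempty because a decomposition has size at least 1 and lattices supply joins of nonempty finite
  sets.\<close>

lemma finite_join_of_irreducibles:
  assumes "lattice Q" and dcc: "\<forall>S \<subseteq> carrier Q. S \<noteq> {} \<longrightarrow> (\<exists>m. minimal_in Q S m)"
    and v: "v \<in> carrier Q" "\<not> minimal_in Q (carrier Q) v"
  shows "\<exists>A. finite A \<and> A \<noteq> {} \<and> (\<forall>a \<in> A. join_irreducible Q a) \<and> \<Squnion>\<^bsub>Q\<^esub>A = v"
proof (rule ccontr)
  interpret lattice Q by fact
  let ?dec = "\<lambda>v. \<exists>A. finite A \<and> A \<noteq> {} \<and> (\<forall>a \<in> A. join_irreducible Q a) \<and> \<Squnion>\<^bsub>Q\<^esub>A = v"
  let ?S = "{v \<in> carrier Q. \<not> minimal_in Q (carrier Q) v \<and> \<not> ?dec v}"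
  have sub: "?S \<subseteq> carrier Q" by blast
  assume "\<not> ?dec v"
  then have "?S \<noteq> {}" using v by blast
  with dcc sub obtain m where "minimal_in Q ?S m" by meson
  then have m: "m \<in> carrier Q" "\<not> minimal_in Q (carrier Q) m" "\<not> ?dec m"
    and below: "\<And>y. y \<in> carrier Q \<Longrightarrow> y \<sqsubset>\<^bsub>Q\<^esub> m \<Longrightarrow> \<not> minimal_in Q (carrier Q) y \<Longrightarrow> ?dec y"
    unfolding minimal_in_def by blast+
  have "\<Squnion>\<^bsub>Q\<^esub>{m} = m" using weak_sup_of_singleton[OF m(1)] by (simp only: eq_is_equal)
  then have "\<not> join_irreducible Q m" using m(3) by (metis empty_iff finite.emptyI finite_insert insert_iff)
  then obtain x y where xy: "x \<in> carrier Q" "y \<in> carrier Q" "x \<sqsubset>\<^bsub>Q\<^esub> m" "y \<sqsubset>\<^bsub>Q\<^esub> m" "m = x \<squnion>\<^bsub>Q\<^esub> y"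
    using m(1) unfolding join_irreducible_def by blast
  \<comment> \<open>Minimality of \<open>m\<close> applies only to non-minimal elements of
    \<open>Q\<close>. If one summand \<open>a\<close> were minimal, then
    \<open>a \<sqinter> b = a\<close>, so \<open>a\<close> would lie below \<open>b\<close> and the
    join would be \<open>b\<close>, which is strictly below \<open>m\<close>.\<close>
  have not_min: "\<not> minimal_in Q (carrier Q) a"
    if "a \<in> carrier Q" "b \<in> carrier Q" "b \<sqsubset>\<^bsub>Q\<^esub> m" "m = a \<squnion>\<^bsub>Q\<^esub> b" for a b
  proof
    assume min: "minimal_in Q (carrier Q) a"
    have "a \<sqinter>\<^bsub>Q\<^esub> b \<sqsubseteq>\<^bsub>Q\<^esub> a" using that meet_left by blast
    then have "a \<sqinter>\<^bsub>Q\<^esub> b = a"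
      using min that unfolding minimal_in_def lless_def by (metis eq_is_equal meet_closed)
    then have "a \<sqsubseteq>\<^bsub>Q\<^esub> b" using that meet_right by metis
    then have "m = b" using that le_iff_meet by simp
    then show False using that(3) m(1) by (simp add: lless_def)
  qed
  have "m = y \<squnion>\<^bsub>Q\<^esub> x" using xy join_comm by metis
  then obtain A B where A: "finite A" "A \<noteq> {}" "\<forall>a \<in> A. join_irreducible Q a" "\<Squnion>\<^bsub>Q\<^esub>A = x"
    and B: "finite B" "B \<noteq> {}" "\<forall>a \<in> B. join_irreducible Q a" "\<Squnion>\<^bsub>Q\<^esub>B = y"
    using below[OF xy(1,3) not_min] below[OF xy(2,4) not_min] xy by metis
  have AB: "A \<subseteq> carrier Q" "B \<subseteq> carrier Q"
    using A(3) B(3) by (auto simp: join_irreducible_def)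
  have luA: "least Q x (Upper Q A)" and luB: "least Q y (Upper Q B)"
    using finite_sup_least[OF A(1) AB(1) A(2)] finite_sup_least[OF B(1) AB(2) B(2)] A(4) B(4) by auto
  have "least Q m (Upper Q (A \<union> B))"
  proof (rule least_UpperI)
    show "z \<sqsubseteq>\<^bsub>Q\<^esub> m" if "z \<in> A \<union> B" for z
    proof -
      have "z \<in> carrier Q" using that AB by blast
      moreover have "z \<sqsubseteq>\<^bsub>Q\<^esub> x \<or> z \<sqsubseteq>\<^bsub>Q\<^esub> y"
        using that least_Upper_above[OF luA _ AB(1)] least_Upper_above[OF luB _ AB(2)] by blast
      moreover have "x \<sqsubseteq>\<^bsub>Q\<^esub> m" "y \<sqsubseteq>\<^bsub>Q\<^esub> m" using xy by (auto simp: lless_def)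
      ultimately show ?thesis using le_trans m(1) xy by blast
    qed
    show "m \<sqsubseteq>\<^bsub>Q\<^esub> z" if z: "z \<in> Upper Q (A \<union> B)" for z
    proof -
      have zc: "z \<in> carrier Q" using subsetD[OF Upper_closed z] .
      have "z \<in> Upper Q A" "z \<in> Upper Q B" using z by (auto simp: Upper_def)
      then have "x \<sqsubseteq>\<^bsub>Q\<^esub> z" "y \<sqsubseteq>\<^bsub>Q\<^esub> z"
        using least_le[OF luA] least_le[OF luB] by auto
      then show ?thesis using join_le xy zc by metis
    qed
  qed (use AB m in auto)
  moreover have "least Q (\<Squnion>\<^bsub>Q\<^esub>(A \<union> B)) (Upper Q (A \<union> B))"
    using finite_sup_least[of "A \<union> B"] A B AB by simp
  ultimately have "\<Squnion>\<^bsub>Q\<^esub>(A \<union> B) = m" using least_unique by blast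
  then show False using m(3) A B by (metis Un_iff Un_empty finite_UnI)
qed

lemma jdim_finite:
  assumes "lattice Q" and dcc: "\<forall>S \<subseteq> carrier Q. S \<noteq> {} \<longrightarrow> (\<exists>m. minimal_in Q S m)"
    and v: "v \<in> carrier Q"
  shows "\<exists>k. jdim Q v = enat k"
proof (cases "minimal_in Q (carrier Q) v")
  case True
  then show ?thesis by (simp add: jdim_def zero_enat_def)
next
  case False
  let ?dec = "\<lambda>A. finite A \<and> A \<noteq> {} \<and> (\<forall>a \<in> A. join_irreducible Q a) \<and> \<Squnion>\<^bsub>Q\<^esub>A = v"
  have "\<exists>A. ?dec A" using finite_join_of_irreducibles[OF assms(1,2) v False] .
  \<comment> \<open>Least cardinality is what forces the decomposition to be reduced: omitting a
    redundant element would give a smaller one.\<close>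
  then obtain A where A: "?dec A" and least: "\<And>B. ?dec B \<Longrightarrow> card A \<le> card B"
    using ex_has_least_nat[of ?dec _ card] by metis
  define k where "k = card A"
  have k: "k \<ge> 1" using A by (simp add: k_def Suc_le_eq card_gt_0_iff)
  obtain p where p: "bij_betw p {..<k} A"
    using A ex_bij_betw_nat_finite[of A] by (auto simp: k_def atLeast0LessThan)
  have im: "p ` {..<k} = A" using p by (simp add: bij_betw_def)
  have "join_decomposition Q v k p"
    using A k im unfolding join_decomposition_def by (auto simp: join_irreducible_def)
  \<comment> \<open>For size 1 reducedness is the convention that \<open>v\<close> is not minimal.
    For larger size, removing one element leaves a nonempty set, hence again a candidate in the
    cardinality comparison.\<close>
  moreover have "\<Squnion>\<^bsub>Q\<^esub>(p ` ({..<k} - {i})) \<noteq> v" if i: "i < k" "k \<noteq> 1" for i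
  proof
    assume eq: "\<Squnion>\<^bsub>Q\<^esub>(p ` ({..<k} - {i})) = v"
    have "p ` ({..<k} - {i}) = A - {p i}"
      using p i unfolding bij_betw_def by (auto simp: inj_on_def)
    moreover have pi: "p i \<in> A" using im i by blast
    moreover have "A - {p i} \<noteq> {}"
    proof
      assume "A - {p i} = {}"
      then have "A = {p i}" using pi by blast
      then show False using i(2) by (simp add: k_def)
    qed
    ultimately have "?dec (A - {p i})" using A eq by auto
    then have "card A \<le> card (A - {p i})" by (rule least)
    moreover have "card (A - {p i}) < card A" using A pi by (intro card_Diff1_less) auto
    ultimately show False by simp
  qed
  ultimately have "has_reduced_indecomposable Q v k"
    using False A unfolding has_reduced_indecomposable_def reduced_decomposition_def im[symmetric]
    by (intro exI[of _ p]) simp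
  \<comment> \<open>Once such a \<open>k\<close> exists, \<open>jdim\<close> unfolds to
    \<open>enat\<close> of a natural number, and finiteness asks for no more.\<close>
  then have "\<exists>k. has_reduced_indecomposable Q v k" by blast
  then show ?thesis using False by (simp add: jdim_def)
qed

lemma join_factorization_lattice_jdim_finite:
  assumes "join_factorization_lattice TYPE('q) P" "v \<in> carrier P"
  shows "\<exists>k. jdim P v = enat k"
proof -
  obtain Q :: "'q gorder" and f where Q: "distributive_lattice Q"
    and dcc: "\<forall>S \<subseteq> carrier Q. S \<noteq> {} \<longrightarrow> (\<exists>m. minimal_in Q S m)"
    and f: "f \<in> carrier P \<rightarrow> carrier Q" "\<forall>v \<in> carrier P. jdim Q (f v) = jdim P v"
    using assms(1) unfolding join_factorization_lattice_def by (elim conjE exE)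
  have lat: "lattice Q" using Q by (simp add: distributive_lattice_def)
  have "f v \<in> carrier Q" using f(1) assms(2) by (rule funcset_mem)
  then have "\<exists>k. jdim Q (f v) = enat k" by (rule jdim_finite[OF lat dcc])
  then show ?thesis using f(2) assms(2) by simp
qed


section \<open>Convergence of the codegree approximations\<close>

theorem proposition4p28:
  fixes P :: "'u gorder"
    and M :: "('o, 'a) model_struct"
    and F :: "('u, 'u \<times> 'u, 'o, 'a) ftor"
    and Q T :: "nat \<Rightarrow> ('u, 'u \<times> 'u, 'o, 'a) ftor"
    and q l \<eta> :: "nat \<Rightarrow> ('u, 'u \<times> 'u, 'o, 'a) ntrans"
    and x :: 'u
    and R :: "(nat, nat \<times> nat, 'o, 'a) ftor"
    and c \<iota> :: "(nat, nat \<times> nat, 'o, 'a) ntrans"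
    and L :: 'o
  assumes "join_factorization_lattice TYPE('q) P"
    and "good_model_category TYPE('u) M"
    and "is_functor (poset_cat P) M F"
    and "codegree_choices P M F Q q l T \<eta>"
    and "x \<in> carrier P"
    and "is_hocolim (poset_cat nat_poset) M (codegree_telescope P M l T \<eta> x) R c L \<iota>"
  shows "hocolim_induced (poset_cat nat_poset) M c L \<iota> (fobj F x) (codegree_cocone P M F q l T \<eta> x)
           \<in> Weq M"
proof -
  interpret model_category "TYPE('u)" M
    using assms(2) unfolding good_model_category_def by blast
  interpret P: lattice P
    using assms(1) unfolding join_factorization_lattice_def distributive_lattice_def by blast
  let ?J = "poset_cat nat_poset" and ?P = "poset_cat P"
  let ?A = "\<lambda>k. Pcat P k" and ?K = "\<lambda>k. incl (Pcat P k)"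
  note M = category_axioms
  have cP: "category ?P"
    by (rule category_poset_cat) (auto intro: P.le_trans)
  have car: "carrier (jdim_le P k) = {v \<in> carrier P. jdim P v \<le> enat k}" and le: "le (jdim_le P k) = le P"
    for k by (simp_all add: jdim_le_def)
  have cA: "category (?A k)" for k
    by (rule category_poset_cat) (auto simp: car le intro: P.le_trans)
  have K: "is_functor (?A k) ?P (?K k)" for k
    by (rule is_functor_incl_poset[OF cA]) (auto simp: car le)
  \<comment> \<open>\<open>incl\<close> depends only on its source, so the same record
    \<open>?K k\<close> is the inclusion into \<open>P\<close> and into the next truncation.\<close>
  have K': "is_functor (?A k) (?A (Suc k)) (?K k)" for k
    by (rule is_functor_incl_poset[OF cA]) (auto simp: car le intro: order_trans)
  have AP: "v \<in> carrier P" and AS: "v \<in> carrier (jdim_le P (Suc k))"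
    if "v \<in> carrier (jdim_le P k)" for v k
    using that by (auto simp: car intro: order_trans)

  have q: "q k \<in> hom (Fun (?A k) M) (Q k) (fcomp (?A k) F (?K k))"
    and qW: "q k \<in> Weq (proj_model (?A k) M)"
    and l: "l k \<in> hom (Fun (?A k) M) (Q k) (fcomp (?A k) (Q (Suc k)) (?K k))"
    and ql: "whisker (?A k) (q (Suc k)) (?K k) \<cdot>\<^bsub>Fun (?A k) M\<^esub> l k = q k"
    and kan: "is_left_kan_extension (?A k) ?P M (?K k) (Q k) (T k) (\<eta> k)" for k
    using assms(4) unfolding codegree_choices_def by auto
  have \<eta>: "\<eta> k \<in> hom (Fun (?A k) M) (Q k) (fcomp (?A k) (T k) (?K k))" and fT: "is_functor ?P M (T k)"
    for k using kan[of k] unfolding is_left_kan_extension_def by (auto simp: Fun_def)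

  define \<epsilon> where "\<epsilon> = codegree_counit P M F q T \<eta>"
  define r where "r = codegree_step P M l T \<eta>"
  have \<epsilon>: "\<epsilon> k \<in> hom (Fun ?P M) (T k) F" and \<epsilon>\<eta>: "whisker (?A k) (\<epsilon> k) (?K k) \<cdot>\<^bsub>Fun (?A k) M\<^esub> \<eta> k = q k"
    for k unfolding \<epsilon>_def codegree_counit_def
    using kan_induced_props[OF kan assms(3) q] by auto
  \<comment> \<open>Restricting \<open>T (Suc k)\<close> in two stages or in one gives literally the
    same functor, by extensionality. This puts the whiskered unit after \<open>l k\<close> into the
    hom-set that the universal property of \<open>T k\<close> expects.\<close>
  have restr: "fcomp (?A k) (fcomp (?A (Suc k)) (T (Suc k)) (?K (Suc k))) (?K k) = fcomp (?A k) (T (Suc k)) (?K k)"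
    for k using AS by (auto simp: fcomp_def incl_def fun_eq_iff car le)
  have \<eta>l: "whisker (?A k) (\<eta> (Suc k)) (?K k) \<cdot>\<^bsub>Fun (?A k) M\<^esub> l k \<in>
      hom (Fun (?A k) M) (Q k) (fcomp (?A k) (T (Suc k)) (?K k))" for k
    using Comp_Fun_in_hom[OF cA M l whisker_in_hom[OF cA K' \<eta>]] unfolding restr .
  have r: "r k \<in> hom (Fun ?P M) (T k) (T (Suc k))"
    and r\<eta>: "whisker (?A k) (r k) (?K k) \<cdot>\<^bsub>Fun (?A k) M\<^esub> \<eta> k =
      whisker (?A k) (\<eta> (Suc k)) (?K k) \<cdot>\<^bsub>Fun (?A k) M\<^esub> l k" for k
    unfolding r_def codegree_step_def using kan_induced_props[OF kan fT \<eta>l] by auto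

  have comps: "ncomp (\<epsilon> k) v \<cdot>\<^bsub>M\<^esub> ncomp (\<eta> k) v = ncomp (q k) v"
    "ncomp (r k) v \<cdot>\<^bsub>M\<^esub> ncomp (\<eta> k) v = ncomp (\<eta> (Suc k)) v \<cdot>\<^bsub>M\<^esub> ncomp (l k) v"
    "ncomp (q (Suc k)) v \<cdot>\<^bsub>M\<^esub> ncomp (l k) v = ncomp (q k) v"
    if v: "v \<in> carrier (jdim_le P k)" for v k
    using arg_cong[OF \<epsilon>\<eta>[of k], of "\<lambda>\<tau>. ncomp \<tau> v"] arg_cong[OF r\<eta>[of k], of "\<lambda>\<tau>. ncomp \<tau> v"]
      arg_cong[OF ql[of k], of "\<lambda>\<tau>. ncomp \<tau> v"] v
    by (simp_all add: ncomp_Comp_Fun ncomp_whisker incl_def)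
  have homs: "ncomp (\<eta> k) v \<in> hom M (fobj (Q k) v) (fobj (T k) v)"
    "ncomp (q k) v \<in> hom M (fobj (Q k) v) (fobj F v)"
    "ncomp (l k) v \<in> hom M (fobj (Q k) v) (fobj (Q (Suc k)) v)"
    if v: "v \<in> carrier (jdim_le P k)" for v k
    using hom_FunD(6)[OF \<eta>[of k], of v] hom_FunD(6)[OF q[of k], of v] hom_FunD(6)[OF l[of k], of v] v
    by (simp_all add: fcomp_def incl_def)
  have \<epsilon>_hom: "ncomp (\<epsilon> k) v \<in> hom M (fobj (T k) v) (fobj F v)"
    and r_hom: "ncomp (r k) v \<in> hom M (fobj (T k) v) (fobj (T (Suc k)) v)"
    if "v \<in> carrier P" for v k
    using hom_FunD(6)[OF \<epsilon>] hom_FunD(6)[OF r] that by simp_all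

  \<comment> \<open>By uniqueness of induced maps it is enough to compare both sides after the unit.
    There the left side unwinds to \<open>q (Suc k)\<close> after \<open>l k\<close>, which is
    \<open>q k\<close> by the choice of \<open>l k\<close>.\<close>
  have \<epsilon>r: "\<epsilon> (Suc k) \<cdot>\<^bsub>Fun ?P M\<^esub> r k = \<epsilon> k" for k
  proof -
    have \<epsilon>r_hom: "\<epsilon> (Suc k) \<cdot>\<^bsub>Fun ?P M\<^esub> r k \<in> hom (Fun ?P M) (T k) F"
      by (rule Comp_Fun_in_hom[OF cP M r \<epsilon>])
    have "whisker (?A k) (\<epsilon> (Suc k) \<cdot>\<^bsub>Fun ?P M\<^esub> r k) (?K k) \<cdot>\<^bsub>Fun (?A k) M\<^esub> \<eta> k = q k"
    proof (rule hom_Fun_eqI[OF Comp_Fun_in_hom[OF cA M \<eta> whisker_in_hom[OF cA K \<epsilon>r_hom]] q])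
      fix v assume "v \<in> Obj (?A k)"
      then have v: "v \<in> carrier (jdim_le P k)" by simp
      note v' = AP[OF v] AS[OF v]
      have "ncomp (\<epsilon> (Suc k)) v \<cdot>\<^bsub>M\<^esub> ncomp (r k) v \<cdot>\<^bsub>M\<^esub> ncomp (\<eta> k) v =
          ncomp (\<epsilon> (Suc k)) v \<cdot>\<^bsub>M\<^esub> ncomp (\<eta> (Suc k)) v \<cdot>\<^bsub>M\<^esub> ncomp (l k) v"
        using Comp_assoc[OF homs(1)[OF v] r_hom[OF v'(1)] \<epsilon>_hom[OF v'(1)]] comps(2)[OF v]
          Comp_assoc[OF homs(3)[OF v] homs(1)[OF v'(2)] \<epsilon>_hom[OF v'(1)]] by simp
      also have "\<dots> = ncomp (q k) v"
        using comps(1)[OF v'(2)] comps(3)[OF v] by simp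
      finally show "ncomp (whisker (?A k) (\<epsilon> (Suc k) \<cdot>\<^bsub>Fun ?P M\<^esub> r k) (?K k) \<cdot>\<^bsub>Fun (?A k) M\<^esub> \<eta> k) v =
          ncomp (q k) v"
        using v v' by (simp add: ncomp_Comp_Fun ncomp_whisker incl_def)
    qed
    then show ?thesis
      using kan_induced_eqI[OF kan assms(3) q \<epsilon>r_hom] by (simp add: \<epsilon>_def codegree_counit_def)
  qed

  obtain k0 where k0: "jdim P x = enat k0"
    using join_factorization_lattice_jdim_finite[OF assms(1,5)] by blast
  \<comment> \<open>At \<open>x\<close> the counit composed with the unit is \<open>q k\<close>, an
    objectwise weak equivalence. With the unit a weak equivalence too, two-of-three applies.\<close>
  have \<epsilon>W: "ncomp (\<epsilon> k) x \<in> Weq M" if "k \<ge> k0" for k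
  proof -
    have x: "x \<in> carrier (jdim_le P k)" using that k0 assms(5) by (simp add: car)
    have "ncomp (\<eta> k) x \<in> Weq M"
      by (rule kan_unit_Weq[OF cP cA _ le kan x]) (auto simp: car)
    moreover have "ncomp (q k) x \<in> Weq M"
      using qW[of k] x by (simp add: proj_model_def)
    ultimately show ?thesis
      using two_of_three[OF homs(1)[OF x] \<epsilon>_hom[OF assms(5)]] comps(1)[OF x] by auto
  qed

  define D where "D = codegree_telescope P M l T \<eta> x"
  define \<kappa> where "\<kappa> = codegree_cocone P M F q l T \<eta> x"
  have cofR: "cofibrant (proj_model ?J M) R" and c: "c \<in> hom (Fun ?J M) R D"
    and cW: "c \<in> Weq (proj_model ?J M)" and colim: "is_colimit ?J M R L \<iota>"
    using assms(6) unfolding is_hocolim_def D_def by auto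
  \<comment> \<open>That the telescope is a functor is read off from its being the codomain of
    \<open>c\<close>.\<close>
  note fR = hom_FunD(1)[OF c] and fD = hom_FunD(2)[OF c]
  have X: "fobj F x \<in> Obj M" using functorD(1)[OF assms(3)] assms(5) by simp
  let ?X = "const_functor ?J M (fobj F x)"
  have D_obj: "fobj D n = fobj (T n) x" and \<kappa>_comp: "ncomp \<kappa> n = ncomp (\<epsilon> n) x" for n
    by (simp_all add: D_def codegree_telescope_def telescope_def \<kappa>_def codegree_cocone_def \<epsilon>_def)
  have D_step: "farr D (n, Suc n) = ncomp (r n) x" for n
    using Comp_Id[OF r_hom[OF assms(5)]]
    by (simp add: D_def codegree_telescope_def telescope_def r_def)
  have \<kappa>: "\<kappa> \<in> hom (Fun ?J M) D ?X"
  proof (rule nat_cocone_in_hom[OF M fD X])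
    show "ndom \<kappa> = D" "ncod \<kappa> = ?X" by (simp_all add: \<kappa>_def codegree_cocone_def D_def)
    show "ncomp \<kappa> n \<in> hom M (fobj D n) (fobj F x)" for n
      using \<epsilon>_hom[OF assms(5)] by (simp add: \<kappa>_comp D_obj)
    show "ncomp \<kappa> (Suc n) \<cdot>\<^bsub>M\<^esub> farr D (n, Suc n) = ncomp \<kappa> n" for n
      using arg_cong[OF \<epsilon>r[of n], of "\<lambda>\<tau>. ncomp \<tau> x"] assms(5)
      by (simp add: \<kappa>_comp D_step ncomp_Comp_Fun)
  qed
  let ?\<mu> = "\<kappa> \<cdot>\<^bsub>Fun ?J M\<^esub> c"
  note \<mu> = Comp_Fun_in_hom[OF category_nat M c \<kappa>]
  have \<mu>_hom: "ncomp ?\<mu> n \<in> hom M (fobj R n) (fobj F x)" for n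
    using hom_FunD(6)[OF \<mu>, of n] by (simp add: const_functor_def)
  have \<mu>W: "ncomp ?\<mu> n \<in> Weq M" if "n \<ge> k0" for n
  proof -
    have "ncomp c n \<in> Weq M" using cW by (simp add: proj_model_def)
    moreover have c_hom: "ncomp c n \<in> hom M (fobj R n) (fobj (T n) x)"
      using hom_FunD(6)[OF c, of n] by (simp add: D_obj)
    ultimately have "ncomp (\<epsilon> n) x \<cdot>\<^bsub>M\<^esub> ncomp c n \<in> Weq M"
      using two_of_three[OF c_hom \<epsilon>_hom[OF assms(5)]] \<epsilon>W[OF that] by blast
    then show ?thesis by (simp add: ncomp_Comp_Fun \<kappa>_comp)
  qed
  have R_arr: "farr R (n, Suc n) \<in> hom M (fobj R n) (fobj R (Suc n))" for n
    using functorD(2)[OF fR, of "(n, Suc n)" n "Suc n"] by simp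
  \<comment> \<open>The cocone maps at stages \<open>n\<close> and \<open>Suc n\<close> are weak
    equivalences and form a triangle over \<open>F x\<close> with the arrow of \<open>R\<close>, so
    this arrow is one as well.\<close>
  have acyc: "farr R (n, Suc n) \<in> Cof M \<inter> Weq M" if n: "n \<ge> k0" for n
  proof -
    have "ncomp ?\<mu> (Suc n) \<cdot>\<^bsub>M\<^esub> farr R (n, Suc n) = ncomp ?\<mu> n"
      using hom_FunD(7)[OF \<mu>, of "(n, Suc n)" n "Suc n"] Id_Comp[OF \<mu>_hom] by (simp add: const_functor_def)
    then have "farr R (n, Suc n) \<in> Weq M"
      using two_of_three[OF R_arr \<mu>_hom, of n] \<mu>W[OF n] \<mu>W[OF le_SucI[OF n]] by simp
    then show ?thesis using cofibrant_telescope_Cof[OF cofR] by simp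
  qed
  have \<iota>W: "ncomp \<iota> k0 \<in> Weq M"
    using telescope_colimit_Weq[OF fR colim acyc] .
  have "\<iota> \<in> hom (Fun ?J M) R (const_functor ?J M L)"
    using colim unfolding is_colimit_def by blast
  from hom_FunD(6)[OF this, of k0] have \<iota>_hom: "ncomp \<iota> k0 \<in> hom M (fobj R k0) L"
    by (simp add: const_functor_def)
  \<comment> \<open>Only the component at \<open>k0\<close> of the defining equations of
    \<open>u\<close> is used: it expresses the weak equivalence \<open>ncomp ?\<mu> k0\<close> as
    \<open>u\<close> after \<open>ncomp \<iota> k0\<close>.\<close>
  define u where "u = hocolim_induced ?J M c L \<iota> (fobj F x) \<kappa>"
  have "\<exists>!u. u \<in> hom M L (fobj F x) \<and> (\<forall>j \<in> Obj ?J. u \<cdot>\<^bsub>M\<^esub> ncomp \<iota> j = ncomp ?\<mu> j)"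
    using colim X \<mu> unfolding is_colimit_def by blast
  from theI'[OF this] have u: "u \<in> hom M L (fobj F x)" and "u \<cdot>\<^bsub>M\<^esub> ncomp \<iota> k0 = ncomp ?\<mu> k0"
    unfolding u_def hocolim_induced_def colim_induced_def by auto
  then have "u \<in> Weq M"
    using two_of_three[OF \<iota>_hom u] \<iota>W \<mu>W[of k0] by simp
  then show ?thesis unfolding u_def \<kappa>_def .
qed

end
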